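(* Let $n$ be a positive integer. Any randomized (or deterministic) mechanism that decides SR solvability on instances with $n$ agents, using adaptive Boolean query access to the agents' preferences, requires $\Omega(n^2)$ Boolean queries in expectation. This bound holds even if queries may be made to fixed batches of agents of size up to $n/2$; that is, the agents are partitioned in advance, independently of the preferences, into batches each containing at most $n/2$ agents, and each query may be an arbitrary Boolean function of the preferences of the agents in a single batch.
   Context: An instance of the Stable Roommates problem (SR) consists of a finite set $S$ of agents together with, for each agent, a preference list that strictly ranks all other agents. Agent $a$ prefers $b$ to $c$ if $b$ appears before $c$ on $a$'s list. A matching is a partition of $S$ into pairs. Given a matching $M$, a pair $\{a,b\}\notin M$ is a blocking pair if $a$ prefers $b$ to its partner in $M$ and $b$ prefers $a$ to its partner in $M$. A matching with no blocking pair is stable. An instance is solvable if it admits a stable matching, and SR solvability is the problem of deciding whether a given instance is solvable. In the query model, the mechanism adaptively chooses Boolean queries, and later queries may depend on answers to earlier ones; a randomized mechanism must output the correct answer with bounded error (for example, with probability at least $2/3$) on every instance. The cost of a mechanism is the number of queries it makes.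
   Formalization: The bound is stated for even n only: for odd n the agents cannot be partitioned into pairs, so no instance is solvable and a mechanism that always answers "not solvable" is correct with zero queries. *)

theory Defs
  imports "HOL-Probability.Probability"
begin

type_synonym 'a profile = "'a \<Rightarrow> 'a list"

definition sr_instance :: "'a set \<Rightarrow> 'a profile \<Rightarrow> bool" where
  "sr_instance S P \<longleftrightarrow>
     finite S \<and> (\<forall>a\<in>S. distinct (P a) \<and> set (P a) = S - {a})"

definition prefers :: "'a profile \<Rightarrow> 'a \<Rightarrow> 'a \<Rightarrow> 'a \<Rightarrow> bool" where
  "prefers P a b c \<longleftrightarrow>
     (\<exists>i j. i < j \<and> j < length (P a) \<and> P a ! i = b \<and> P a ! j = c)"

definition matching :: "'a set \<Rightarrow> 'a set set \<Rightarrow> bool" where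
  "matching S M \<longleftrightarrow> partition_on S M \<and> (\<forall>e\<in>M. card e = 2)"

definition partner :: "'a set set \<Rightarrow> 'a \<Rightarrow> 'a" where
  "partner M a = (THE b. b \<noteq> a \<and> {a, b} \<in> M)"

definition blocking_pair :: "'a set \<Rightarrow> 'a profile \<Rightarrow> 'a set set \<Rightarrow> 'a \<Rightarrow> 'a \<Rightarrow> bool" where
  "blocking_pair S P M a b \<longleftrightarrow>
     a \<in> S \<and> b \<in> S \<and> a \<noteq> b \<and> {a, b} \<notin> M \<and>
     prefers P a b (partner M a) \<and> prefers P b a (partner M b)"

definition stable_matching :: "'a set \<Rightarrow> 'a profile \<Rightarrow> 'a set set \<Rightarrow> bool" where
  "stable_matching S P M \<longleftrightarrow> matching S M \<and> (\<nexists>a b. blocking_pair S P M a b)"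

definition solvable :: "'a set \<Rightarrow> 'a profile \<Rightarrow> bool" where
  "solvable S P \<longleftrightarrow> (\<exists>M. stable_matching S P M)"

text \<open>
  Deterministic adaptive mechanisms are finite decision trees. A node \<open>Query B f t u\<close> asks
  the Boolean question \<open>f\<close> and continues with \<open>t\<close> on answer yes and with \<open>u\<close> on answer no.
  The question is evaluated on the profile restricted to \<open>B\<close>, so the answer can depend
  only on the preference lists of the agents in \<open>B\<close>.
\<close>

datatype 'a mechanism =
    Output bool
  | Query "'a set" "'a profile \<Rightarrow> bool" "'a mechanism" "'a mechanism"

primrec run :: "'a mechanism \<Rightarrow> 'a profile \<Rightarrow> bool" where
  "run (Output v) P = v"
| "run (Query B f t u) P = (if f (restrict P B) then run t P else run u P)"

primrec num_queries :: "'a mechanism \<Rightarrow> 'a profile \<Rightarrow> nat" where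
  "num_queries (Output v) P = 0"
| "num_queries (Query B f t u) P =
     Suc (if f (restrict P B) then num_queries t P else num_queries u P)"

primrec queries_only :: "'a set set \<Rightarrow> 'a mechanism \<Rightarrow> bool" where
  "queries_only \<B> (Output v) \<longleftrightarrow> True"
| "queries_only \<B> (Query B f t u) \<longleftrightarrow> B \<in> \<B> \<and> queries_only \<B> t \<and> queries_only \<B> u"

definition batching :: "'a set \<Rightarrow> 'a set set \<Rightarrow> bool" where
  "batching S \<B> \<longleftrightarrow> partition_on S \<B> \<and> (\<forall>B\<in>\<B>. real (card B) \<le> real (card S) / 2)"

definition deterministic_decider :: "'a set \<Rightarrow> 'a set set \<Rightarrow> 'a mechanism \<Rightarrow> bool" where
  "deterministic_decider S \<B> t \<longleftrightarrow>
     queries_only \<B> t \<and> (\<forall>P. sr_instance S P \<longrightarrow> run t P = solvable S P)"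

text \<open>
  A randomized mechanism is a probability distribution over deterministic ones. The
  sigma-algebra is arbitrary subject to the output and the number of queries on each
  instance being random variables; distributions need not be discrete.
\<close>

definition randomized_mechanism :: "'a set \<Rightarrow> 'a set set \<Rightarrow> 'a mechanism measure \<Rightarrow> bool" where
  "randomized_mechanism S \<B> D \<longleftrightarrow>
     prob_space D \<and> (\<forall>t\<in>space D. queries_only \<B> t) \<and>
     (\<forall>P. sr_instance S P \<longrightarrow>
        (\<lambda>t. run t P) \<in> measurable D (count_space UNIV) \<and>
        (\<lambda>t. num_queries t P) \<in> measurable D (count_space UNIV))"

definition randomized_decider ::
  "real \<Rightarrow> 'a set \<Rightarrow> 'a set set \<Rightarrow> 'a mechanism measure \<Rightarrow> bool" where
  "randomized_decider p S \<B> D \<longleftrightarrow>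
     randomized_mechanism S \<B> D \<and>
     (\<forall>P. sr_instance S P \<longrightarrow> measure D {t \<in> space D. run t P = solvable S P} \<ge> p)"

text \<open>The expected number of queries takes values in the extended reals, as it may be infinite.\<close>

definition expected_queries :: "'a mechanism measure \<Rightarrow> 'a profile \<Rightarrow> ennreal" where
  "expected_queries D P = (\<integral>\<^sup>+ t. ennreal (real (num_queries t P)) \<partial>D)"

end

theory Submission
  imports Defs
begin

text \<open>
  Some union of batches contains between a quarter and a half of the agents, so a mechanism is a two-party
  protocol between this set of agents and its complement. Two players holding sets \<open>x\<close> and \<open>y\<close> of
  pairs from \<open>A \<times> B\<close>, with \<open>A\<close> and \<open>B\<close> on different sides and of size linear in \<open>n\<close>, can set up an
  instance that is solvable iff \<open>x\<close> and \<open>y\<close> are disjoint: \<open>a\<close> and \<open>b\<close> block the intended matching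
  iff \<open>(a, b) \<in> x \<inter> y\<close>, and leaving that matching triggers a cyclic triple.

  Disjointness on \<open>N = card A * card B\<close> coordinates needs of order \<open>N\<close> queries by the
  information-cost argument of Bar-Yossef, Jayram, Kumar and Sivakumar. On random disjoint inputs in which each
  coordinate is owned by one player, the entropy of the transcript is at most the expected number of queries,
  and by the level-one inequality it bounds the total effect on the transcript distribution of flipping single
  coordinates. The rectangle property turns this into a bound on the Hellinger distance between the transcript
  distributions for \<open>(0, 0)\<close> and \<open>(1, 1)\<close> in a typical coordinate, which a correct mechanism must keep
  bounded away from zero.
\<close>

section \<open>Level-one inequality\<close>

text \<open>With \<open>x = s\<^sup>2\<close>, the bound \<open>ln s \<ge> 1 - 1 / s\<close> leaves
  the remainder \<open>(s - 1)\<^sup>2\<close>. The constant comes from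
  \<open>(x - 1)\<^sup>2 = (s + 1)\<^sup>2 * (s - 1)\<^sup>2\<close> and
  \<open>(1 + sqrt 2)\<^sup>2 < 6\<close>.\<close>

lemma xlnx_ge:
  fixes x :: real
  assumes "0 \<le> x" "x \<le> 2"
  shows "x * ln x \<ge> x - 1 + (x - 1)\<^sup>2 / 6"
proof (cases "x = 0")
  case True
  then show ?thesis by simp
next
  case False
  define s where "s = sqrt x"
  have s: "s > 0" "x = s\<^sup>2" using False assms by (auto simp: s_def)
  have "s \<le> sqrt 2" using assms by (simp add: s_def)
  also have "sqrt 2 < (1.42::real)" by (rule real_less_lsqrt) (auto simp: power2_eq_square)
  finally have s2: "s < 1.42" .
  have "(s + 1)\<^sup>2 \<le> (2.42::real)\<^sup>2" using s s2 by (intro power_mono) auto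
  also have "\<dots> \<le> 6" by (simp add: power2_eq_square)
  finally have "(s + 1)\<^sup>2 * (s - 1)\<^sup>2 \<le> 6 * (s - 1)\<^sup>2" by (intro mult_right_mono) auto
  moreover have "(s + 1)\<^sup>2 * (s - 1)\<^sup>2 = (x - 1)\<^sup>2"
    by (simp add: s(2) power2_eq_square algebra_simps)
  ultimately have *: "(x - 1)\<^sup>2 / 6 \<le> (s - 1)\<^sup>2" by simp
  have "ln (1 / s) \<le> 1 / s - 1" using s by (intro ln_le_minus_one) auto
  then have "ln s \<ge> 1 - 1 / s" using s by (simp add: ln_div)
  then have "s\<^sup>2 * (2 * ln s) \<ge> s\<^sup>2 * (2 * (1 - 1 / s))" by (intro mult_left_mono) auto
  moreover have "ln x = 2 * ln s" using s by (simp add: ln_realpow)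
  moreover have "s\<^sup>2 * (2 * (1 - 1 / s)) = x - 1 + (s - 1)\<^sup>2"
    using s by (simp add: power2_eq_square field_simps)
  ultimately show ?thesis using * s(2) by simp
qed

text \<open>Pinsker's inequality for a two-point distribution against the uniform one, scaled by the
  mass \<open>p + q\<close> so that it applies to cardinalities. The normalised weights
  \<open>u\<close> and \<open>v\<close> sum to 2, so the linear terms of \<open>xlnx_ge\<close>
  cancel.\<close>

lemma binary_pinsker:
  fixes p q :: real
  assumes "0 \<le> p" "0 \<le> q" "0 < p + q"
  shows "(p - q)\<^sup>2 / (p + q) \<le> 6 * (p * ln (2 * p / (p + q)) + q * ln (2 * q / (p + q)))"
proof -
  define T where "T = p + q"
  define u where "u = 2 * p / T"
  define v where "v = 2 * q / T"
  have T: "T > 0" using assms by (simp add: T_def)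
  have "u * ln u \<ge> u - 1 + (u - 1)\<^sup>2 / 6" "v * ln v \<ge> v - 1 + (v - 1)\<^sup>2 / 6"
    by (intro xlnx_ge; use assms in \<open>simp add: u_def v_def T_def field_simps\<close>)+
  moreover have "v = 2 - u" using T by (simp add: u_def v_def T_def field_simps)
  ultimately have "(u - 1)\<^sup>2 / 3 \<le> u * ln u + v * ln v"
    by (simp add: power2_commute)
  then have "3 * T * ((u - 1)\<^sup>2 / 3) \<le> 3 * T * (u * ln u + v * ln v)"
    using T by (intro mult_left_mono) auto
  moreover have "3 * T * ((u - 1)\<^sup>2 / 3) = (p - q)\<^sup>2 / T"
  proof -
    have "u - 1 = (p - q) / T" using T by (simp add: u_def T_def field_simps)
    then show ?thesis using T by (simp add: power_divide power2_eq_square)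
  qed
  moreover have "3 * T * (u * ln u + v * ln v) = 6 * (p * ln u + q * ln v)"
    using T by (simp add: u_def v_def field_simps)
  ultimately show ?thesis
    unfolding T_def[symmetric] u_def[symmetric] v_def[symmetric] by simp
qed

text \<open>Cauchy-Schwarz in Engel form; it recombines the two halves of the cube in the induction
  below.\<close>

lemma square_add_divide_le:
  fixes a b p q :: real
  assumes "0 < p" "0 < q"
  shows "(a + b)\<^sup>2 / (p + q) \<le> a\<^sup>2 / p + b\<^sup>2 / q"
proof -
  have "0 \<le> (a * q - b * p)\<^sup>2" by simp
  then have "(a + b)\<^sup>2 * (p * q) \<le> (a\<^sup>2 * q + b\<^sup>2 * p) * (p + q)"
    by (simp add: power2_eq_square algebra_simps)
  then show ?thesis using assms by (simp add: field_simps)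
qed

text \<open>Up to sign and scaling, the degree-one Fourier coefficient at \<open>k\<close> of the
  indicator of \<open>L\<close>, with sets read as points of the Boolean cube.\<close>

definition bias :: "'u \<Rightarrow> 'u set set \<Rightarrow> real" where
  "bias k L = (\<Sum>z\<in>L. if k \<in> z then 1 else -1)"

lemma bias_empty [simp]: "bias k {} = 0"
  by (simp add: bias_def)

text \<open>Induction on coordinates: splitting \<open>L\<close> by coordinate \<open>k\<close>, the
  biases at the other coordinates are handled by convexity and the induction hypothesis, and the
  bias at \<open>k\<close> by Pinsker's inequality for the split.\<close>

lemma level_one_inequality:
  assumes "finite U" "L \<subseteq> Pow U"
  shows "(\<Sum>k\<in>U. (bias k L)\<^sup>2 / card L) \<le> 6 * (card L * ln (2 ^ card U / card L))"
  using assms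
proof (induction U arbitrary: L rule: finite_induct)
  case empty
  then have "L = {} \<or> L = {{}}" by auto
  then show ?case by auto
next
  case (insert k U)
  define L0 where "L0 = {z\<in>L. k \<notin> z}"
  define L1' where "L1' = {z\<in>L. k \<in> z}"
  define L1 where "L1 = (\<lambda>z. z - {k}) ` L1'"
  have inj: "inj_on (\<lambda>z. z - {k}) L1'" by (auto simp: inj_on_def L1'_def)
  have finL: "finite L" using insert by (meson finite.insertI finite_Pow_iff finite_subset)
  then have fin: "finite L0" "finite L1'" "finite L1" by (auto simp: L0_def L1'_def L1_def)
  have LU: "L = L0 \<union> L1'" "L0 \<inter> L1' = {}" by (auto simp: L0_def L1'_def)
  have sub: "L0 \<subseteq> Pow U" "L1 \<subseteq> Pow U" using insert.prems by (auto simp: L0_def L1_def L1'_def)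
  define p where "p = real (card L1)"
  define q where "q = real (card L0)"
  have cL1: "card L1' = card L1" by (simp add: L1_def card_image inj)
  have cL: "real (card L) = p + q"
    unfolding p_def q_def cL1[symmetric] using LU fin card_Un_disjoint[of L0 L1'] by simp
  have bk: "bias k L = p - q"
  proof -
    have "bias k L = bias k L0 + bias k L1'"
      unfolding bias_def by (subst LU(1), rule sum.union_disjoint) (use fin LU in auto)
    also have "bias k L0 = - q" by (simp add: bias_def L0_def q_def)
    also have "bias k L1' = p" by (simp add: bias_def L1'_def p_def flip: cL1)
    finally show ?thesis by simp
  qed
  have bj: "bias j L = bias j L0 + bias j L1" if "j \<in> U" for j
  proof -
    have "bias j L = bias j L0 + bias j L1'"
      unfolding bias_def by (subst LU(1), rule sum.union_disjoint) (use fin LU in auto)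
    also have "bias j L1' = bias j L1" unfolding bias_def L1_def
      by (subst sum.reindex[OF inj]) (use that insert.hyps in \<open>auto intro!: sum.cong\<close>)
    finally show ?thesis .
  qed
  let ?N = "(2::real) ^ card U"
  note IH = insert.IH[OF sub(1), folded q_def] insert.IH[OF sub(2), folded p_def]
  \<comment> \<open>An empty half is treated separately, since convexity needs positive masses; as
    \<open>x / 0 = 0\<close>, such a half contributes nothing.\<close>
  consider "p = 0" "q = 0" | "p + q > 0" "p = 0 \<or> q = 0" | "p > 0" "q > 0"
    by (fastforce simp: p_def q_def)
  then show ?case
  proof cases
    case 1
    then have "L = {}" using cL finL by simp
    then show ?thesis by simp
  next
    case 2
    have "(\<Sum>j\<in>U. (bias j L)\<^sup>2 / (p + q)) \<le> (\<Sum>j\<in>U. (bias j L0)\<^sup>2 / q) + (\<Sum>j\<in>U. (bias j L1)\<^sup>2 / p)"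
    proof -
      have "L1 = {} \<or> L0 = {}" using 2 fin by (auto simp: p_def q_def)
      then show ?thesis using 2 by (auto simp: bj p_def q_def)
    qed
    moreover have "(p - q)\<^sup>2 / (p + q) \<le> 6 * (p * ln (2 * p / (p + q)) + q * ln (2 * q / (p + q)))"
      using 2 by (intro binary_pinsker) (auto simp: p_def q_def)
    \<comment> \<open>Chain rule: the divergence of the split and the entropy deficits of the two
      halves add up to the deficit of \<open>L\<close>.\<close>
    moreover have "p * ln (2 * p / (p + q)) + q * ln (2 * q / (p + q)) + p * ln (?N / p) + q * ln (?N / q)
      = (p + q) * ln (2 * ?N / (p + q))"
      using 2 by (auto simp: ln_mult ln_div algebra_simps)
    ultimately show ?thesis using insert.hyps IH by (simp add: bk cL)
  next
    case 3
    have "(\<Sum>j\<in>U. (bias j L)\<^sup>2 / (p + q)) \<le> (\<Sum>j\<in>U. (bias j L0)\<^sup>2 / q + (bias j L1)\<^sup>2 / p)"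
      using 3 by (intro sum_mono) (simp add: bj add.commute[of p q] square_add_divide_le)
    moreover have "(p - q)\<^sup>2 / (p + q) \<le> 6 * (p * ln (2 * p / (p + q)) + q * ln (2 * q / (p + q)))"
      using 3 by (intro binary_pinsker) auto
    moreover have "p * ln (2 * p / (p + q)) + q * ln (2 * q / (p + q)) + p * ln (?N / p) + q * ln (?N / q)
      = (p + q) * ln (2 * ?N / (p + q))"
      using 3 by (simp add: ln_mult ln_div algebra_simps)
    ultimately show ?thesis using insert.hyps IH by (simp add: bk cL sum.distrib)
  qed
qed

section \<open>Transcripts\<close>

text \<open>Binary entropy is at most \<open>ln 2\<close>, scaled to masses. Bounding each logarithm
  by its tangent at \<open>a = b\<close> leaves errors \<open>(b - a) / 2\<close> and
  \<open>(a - b) / 2\<close>, which cancel.\<close>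

lemma split_entropy_le:
  fixes a b :: real
  assumes "0 \<le> a" "0 \<le> b"
  shows "a * ln ((a + b) / a) + b * ln ((a + b) / b) \<le> ln 2 * (a + b)"
proof -
  have *: "a * ln ((a + b) / a) \<le> a * ln 2 + (b - a) / 2" if "0 \<le> a" "0 \<le> b" for a b :: real
  proof (cases "a = 0")
    case False
    then have "ln ((a + b) / (2 * a)) \<le> (a + b) / (2 * a) - 1"
      using that by (intro ln_le_minus_one) auto
    moreover have "ln ((a + b) / (2 * a)) = ln ((a + b) / a) - ln 2"
      using that False by (simp add: ln_div ln_mult)
    ultimately have "a * ln ((a + b) / a) \<le> a * (ln 2 + ((a + b) / (2 * a) - 1))"
      using that by (intro mult_left_mono) auto
    also have "\<dots> = a * ln 2 + (b - a) / 2" using False by (simp add: field_simps)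
    finally show ?thesis .
  qed (use that in auto)
  have "(b - a) / 2 + (a - b) / 2 = 0" by (simp add: field_simps)
  then show ?thesis using *[OF assms] *[OF assms(2,1)]
    by (simp add: algebra_simps add.commute[of b a])
qed

text \<open>For a fixed tree the answers alone identify the leaf reached, so this list serves as the
  transcript of the protocol.\<close>

primrec trace :: "'a mechanism \<Rightarrow> 'a profile \<Rightarrow> bool list" where
  "trace (Output v) P = []"
| "trace (Query B f t u) P =
     (if f (restrict P B) then True # trace t P else False # trace u P)"

lemma run_cong_trace: "trace t P = trace t Q \<Longrightarrow> run t P = run t Q"
  by (induction t) (auto split: if_splits)

text \<open>Each query reads a batch on one side of \<open>A\<close>, where \<open>R\<close>
  coincides with \<open>P\<close> or with \<open>Q\<close>. Both give the same answer along their
  common path, so \<open>R\<close> follows it too.\<close>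

lemma trace_rectangle:
  assumes "queries_only \<B> t" "\<And>B. B \<in> \<B> \<Longrightarrow> B \<subseteq> A \<or> B \<inter> A = {}"
    "trace t P = trace t Q" "\<And>v. v \<in> A \<Longrightarrow> R v = P v" "\<And>v. v \<notin> A \<Longrightarrow> R v = Q v"
  shows "trace t R = trace t P"
  using assms(1,3)
proof (induction t)
  case (Query B f t u)
  then have "B \<subseteq> A \<or> B \<inter> A = {}" using assms(2) by simp
  then have "restrict R B = restrict P B \<or> restrict R B = restrict Q B"
    using assms(4,5) by (auto simp: restrict_def fun_eq_iff)
  with Query show ?case by (auto split: if_splits)
qed simp

text \<open>The answer sequences form a prefix code for the leaves, so their entropy is at most the mean depth.\<close>

lemma trace_entropy_le:
  fixes P :: "'z \<Rightarrow> 'a profile"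
  assumes "finite Z"
  shows "(\<Sum>z\<in>Z. ln (card Z / card {z'\<in>Z. trace t (P z') = trace t (P z)}))
    \<le> ln 2 * (\<Sum>z\<in>Z. real (num_queries t (P z)))"
  using assms
proof (induction t arbitrary: Z)
  case (Output v)
  then show ?case by (cases "Z = {}") auto
next
  case (Query B f t u)
  let ?q = "Query B f t u"
  define Z1 where "Z1 = {z\<in>Z. f (restrict (P z) B)}"
  define Z2 where "Z2 = {z\<in>Z. \<not> f (restrict (P z) B)}"
  have Z: "Z = Z1 \<union> Z2" "Z1 \<inter> Z2 = {}" "finite Z1" "finite Z2"
    using Query.prems by (auto simp: Z1_def Z2_def)
  have cZ: "real (card Z) = card Z1 + card Z2" using Z by (simp add: card_Un_disjoint)
  have split: "(\<Sum>z\<in>Z. h z) = (\<Sum>z\<in>Z1. h z) + (\<Sum>z\<in>Z2. h z)" for h :: "'z \<Rightarrow> real"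
    using Z by (metis sum.union_disjoint)
  have ln_split: "ln (a / c) = ln (a / b) + ln (b / c)" if "0 < a" "0 < b" "0 < c" for a b c :: real
    using that by (simp add: ln_div)
  \<comment> \<open>Within one branch, the class of \<open>z\<close> is its class in the subtree, so
    the logarithm splits into a term for the first answer and one for the rest of the trace.\<close>
  have part: "(\<Sum>z\<in>W. ln (card Z / card {z'\<in>Z. trace ?q (P z') = trace ?q (P z)}))
      \<le> card W * ln (card Z / card W) + ln 2 * (\<Sum>z\<in>W. real (num_queries s (P z)))"
    if W: "W \<subseteq> Z" "\<And>z. z \<in> W \<Longrightarrow> {z'\<in>Z. trace ?q (P z') = trace ?q (P z)} = {z'\<in>W. trace s (P z') = trace s (P z)}"
      and IH: "(\<Sum>z\<in>W. ln (card W / card {z'\<in>W. trace s (P z') = trace s (P z)}))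
    \<le> ln 2 * (\<Sum>z\<in>W. real (num_queries s (P z)))"
    for W s
  proof -
    have fW: "finite W" using W Query.prems finite_subset by blast
    have "ln (card Z / card {z'\<in>Z. trace ?q (P z') = trace ?q (P z)})
      = ln (card Z / card W) + ln (card W / card {z'\<in>W. trace s (P z') = trace s (P z)})" if z: "z \<in> W" for z
    proof -
      have "{z'\<in>W. trace s (P z') = trace s (P z)} \<noteq> {}" using z by auto
      then have "0 < card {z'\<in>W. trace s (P z') = trace s (P z)}" using fW by (simp add: card_gt_0_iff)
      moreover have "0 < card W" "0 < card Z"
        using z fW W Query.prems by (auto simp: card_gt_0_iff)
      ultimately show ?thesis unfolding W(2)[OF z] by (intro ln_split) auto
    qed
    then show ?thesis using IH by (simp add: sum.distrib)
  qed
  have "(\<Sum>z\<in>Z. ln (card Z / card {z'\<in>Z. trace ?q (P z') = trace ?q (P z)}))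
     \<le> (card Z1 * ln (card Z / card Z1) + ln 2 * (\<Sum>z\<in>Z1. real (num_queries t (P z))))
      + (card Z2 * ln (card Z / card Z2) + ln 2 * (\<Sum>z\<in>Z2. real (num_queries u (P z))))"
    unfolding split
    by (intro add_mono part Query.IH Z(3,4)) (auto simp: Z1_def Z2_def)
  \<comment> \<open>The entropy of the first answer is at most \<open>ln 2\<close> per input and is
    charged to the root query, the 1 added to each count.\<close>
  also have "\<dots> \<le> ln 2 * (\<Sum>z\<in>Z1. 1 + real (num_queries t (P z))) + ln 2 * (\<Sum>z\<in>Z2. 1 + real (num_queries u (P z)))"
    using split_entropy_le[of "card Z1" "card Z2"]
    by (simp add: cZ sum.distrib algebra_simps)
  also have "\<dots> = ln 2 * (\<Sum>z\<in>Z. real (num_queries ?q (P z)))"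
    unfolding split distrib_left[symmetric]
    by (intro arg_cong2[where f = "(*)"] arg_cong2[where f = "(+)"] sum.cong) (auto simp: Z1_def Z2_def)
  finally show ?case .
qed

section \<open>Two-party disjointness\<close>

text \<open>Squared Hellinger distance against triangular discrimination, pointwise: factor
  \<open>p - q\<close> and use \<open>(sqrt p + sqrt q)\<^sup>2 \<ge> p + q\<close>.\<close>

lemma sqrt_diff_square_le:
  fixes p q :: real
  assumes "0 \<le> p" "0 \<le> q"
  shows "(sqrt p - sqrt q)\<^sup>2 \<le> (p - q)\<^sup>2 / (p + q)"
proof (cases "p + q = 0")
  case True
  then have "p = 0" "q = 0" using assms by auto
  then show ?thesis by simp
next
  case False
  then have pos: "p + q > 0" using assms by auto
  have "(sqrt p + sqrt q) * (sqrt p - sqrt q) = p - q"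
    using assms by (simp add: algebra_simps)
  then have "(p - q)\<^sup>2 = (sqrt p + sqrt q)\<^sup>2 * (sqrt p - sqrt q)\<^sup>2"
    by (metis power_mult_distrib)
  moreover have "(sqrt p + sqrt q)\<^sup>2 \<ge> p + q"
    using assms by (simp add: power2_sum)
  ultimately have "(p + q) * (sqrt p - sqrt q)\<^sup>2 \<le> (p - q)\<^sup>2"
    by (simp add: mult_right_mono)
  then show ?thesis using pos by (simp add: field_simps)
qed

text \<open>
  The parameter \<open>\<tau>\<close> linearises the Cauchy--Schwarz bound of total variation by Hellinger distance,
  so that the estimate can later be averaged over random mechanisms.
\<close>

lemma hellinger_cut_and_paste:
  fixes p00 p01 p10 p11 :: "'l \<Rightarrow> real" and \<tau> :: real
  assumes fin: "finite \<Lambda>" and C: "C \<subseteq> \<Lambda>" and lam: "\<tau> > 0"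
    and nn: "\<And>l. 0 \<le> p00 l" "\<And>l. 0 \<le> p01 l" "\<And>l. 0 \<le> p10 l" "\<And>l. 0 \<le> p11 l"
    and cut: "\<And>l. p00 l * p11 l = p01 l * p10 l"
    and W: "sum p00 \<Lambda> = W" "sum p01 \<Lambda> = W" "sum p10 \<Lambda> = W" "sum p11 \<Lambda> = W"
  shows "(\<Sum>l\<in>C. p00 l - p11 l) \<le> ((\<Sum>l\<in>\<Lambda>. (p10 l - p00 l)\<^sup>2 / (p10 l + p00 l))
      + (\<Sum>l\<in>\<Lambda>. (p01 l - p00 l)\<^sup>2 / (p01 l + p00 l))) / \<tau> + 2 * \<tau> * W"
proof -
  let ?H = "\<lambda>p q. \<Sum>l\<in>\<Lambda>. (sqrt (p l) - sqrt (q l))\<^sup>2"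
  have H: "?H p q = sum p \<Lambda> + sum q \<Lambda> - 2 * (\<Sum>l\<in>\<Lambda>. sqrt (p l * q l))"
    if "\<And>l. 0 \<le> p l" "\<And>l. 0 \<le> q l" for p q :: "'l \<Rightarrow> real"
    using that by (simp add: power2_diff sum_subtractf sum.distrib sum_distrib_left real_sqrt_mult mult.assoc)
  \<comment> \<open>Cut and paste: with equal total masses, Hellinger distance depends only on the
    pointwise products, which \<open>cut\<close> identifies.\<close>
  have "?H p00 p11 = ?H p01 p10" using nn W by (simp add: H cut)
  \<comment> \<open>Triangle inequality through \<open>p00\<close>: each leg changes the bit of one
    player only.\<close>
  also have "\<dots> \<le> (\<Sum>l\<in>\<Lambda>. 2 * ((p10 l - p00 l)\<^sup>2 / (p10 l + p00 l)) + 2 * ((p01 l - p00 l)\<^sup>2 / (p01 l + p00 l)))"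
  proof (rule sum_mono)
    fix l
    have "(a - b)\<^sup>2 \<le> 2 * (b - c)\<^sup>2 + 2 * (a - c)\<^sup>2" for a b c :: real
    proof -
      have "0 \<le> ((a - c) + (b - c))\<^sup>2" by simp
      then show ?thesis by (simp add: power2_eq_square algebra_simps)
    qed
    from this[of "sqrt (p01 l)" "sqrt (p10 l)" "sqrt (p00 l)"]
    show "(sqrt (p01 l) - sqrt (p10 l))\<^sup>2 \<le> 2 * ((p10 l - p00 l)\<^sup>2 / (p10 l + p00 l)) + 2 * ((p01 l - p00 l)\<^sup>2 / (p01 l + p00 l))"
      using sqrt_diff_square_le[OF nn(3) nn(1), of l l] sqrt_diff_square_le[OF nn(2) nn(1), of l l] by linarith
  qed
  finally have H2: "?H p00 p11 \<le> 2 * ((\<Sum>l\<in>\<Lambda>. (p10 l - p00 l)\<^sup>2 / (p10 l + p00 l))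
      + (\<Sum>l\<in>\<Lambda>. (p01 l - p00 l)\<^sup>2 / (p01 l + p00 l)))" (is "_ \<le> 2 * ?R")
    by (simp add: sum.distrib sum_distrib_left)
  define e where "e l = (sqrt (p00 l) - sqrt (p11 l))\<^sup>2 / (2 * \<tau>) + \<tau> * (p00 l + p11 l)" for l
  have e: "p00 l - p11 l \<le> e l" for l
  proof -
    define s r where "s = sqrt (p00 l)" and "r = sqrt (p11 l)"
    have p: "p00 l = s\<^sup>2" "p11 l = r\<^sup>2" using nn by (simp_all add: s_def r_def)
    \<comment> \<open>The first square is AM-GM for the factors of
      \<open>s\<^sup>2 - r\<^sup>2\<close>; the second completes \<open>(s + r)\<^sup>2\<close> to
      \<open>2 * (s\<^sup>2 + r\<^sup>2)\<close>.\<close>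
    have "0 \<le> ((s - r) - \<tau> * (s + r))\<^sup>2 + \<tau>\<^sup>2 * (s - r)\<^sup>2" by simp
    also have "\<dots> = (s - r)\<^sup>2 + 2 * \<tau>\<^sup>2 * (s\<^sup>2 + r\<^sup>2) - 2 * \<tau> * (s\<^sup>2 - r\<^sup>2)"
      by (simp add: power2_eq_square algebra_simps)
    finally have "s\<^sup>2 - r\<^sup>2 \<le> ((s - r)\<^sup>2 + 2 * \<tau>\<^sup>2 * (s\<^sup>2 + r\<^sup>2)) / (2 * \<tau>)"
      using lam by (simp add: field_simps)
    also have "\<dots> = (s - r)\<^sup>2 / (2 * \<tau>) + \<tau> * (s\<^sup>2 + r\<^sup>2)"
      using lam by (simp add: add_divide_distrib power2_eq_square)
    finally show ?thesis unfolding e_def s_def[symmetric] r_def[symmetric] unfolding p .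
  qed
  have "(\<Sum>l\<in>C. p00 l - p11 l) \<le> (\<Sum>l\<in>C. e l)" by (intro sum_mono e)
  also have "\<dots> \<le> (\<Sum>l\<in>\<Lambda>. e l)"
    using fin C lam nn by (intro sum_mono2) (auto simp: e_def)
  also have "\<dots> = ?H p00 p11 / (2 * \<tau>) + \<tau> * (W + W)"
    by (simp add: e_def sum.distrib sum_divide_distrib W flip: sum_distrib_left)
  also have "\<dots> \<le> 2 * ?R / (2 * \<tau>) + \<tau> * (W + W)"
    using H2 lam by (intro add_right_mono divide_right_mono) auto
  also have "2 * ?R / (2 * \<tau>) = ?R / \<tau>" by (rule mult_divide_mult_cancel_left) simp
  also have "\<tau> * (W + W) = 2 * \<tau> * W" by simp
  finally show ?thesis .
qed

section \<open>Sums over subsets, split at one coordinate\<close>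

lemma sum_Pow_split:
  assumes "finite U" "k \<in> U"
  shows "sum F (Pow U) = (\<Sum>w\<in>Pow (U - {k}). F (insert k w)) + (\<Sum>w\<in>Pow (U - {k}). F w)"
proof -
  have "Pow U = insert k ` Pow (U - {k}) \<union> Pow (U - {k})"
    using Pow_insert[of k "U - {k}"] assms by (simp add: insert_absorb Un_commute)
  moreover have "insert k ` Pow (U - {k}) \<inter> Pow (U - {k}) = {}" by auto
  moreover have "inj_on (insert k) (Pow (U - {k}))" by (auto simp: inj_on_def)
  ultimately show ?thesis using assms by (simp add: sum.union_disjoint sum.reindex)
qed

lemma real_card_Collect_Pow:
  "finite U \<Longrightarrow> real (card {z\<in>Pow U. Q z}) = (\<Sum>z\<in>Pow U. of_bool (Q z))"
  by (simp add: sum.If_cases of_bool_def Int_def)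

lemma real_card_Pow_remove:
  assumes "finite U" "k \<in> U"
  shows "real (card (Pow (U - {k}))) = 2 ^ card U / 2"
proof -
  have "card U = Suc (card (U - {k}))" using card_Suc_Diff1[OF assms] by simp
  then show ?thesis using assms(1) by (simp add: card_Pow del: card_Diff_insert card_Diff_singleton)
qed

text \<open>
  Hard inputs: the set \<open>D\<close> of coordinates belongs to the first player and its complement to the second,
  so that \<open>(z \<inter> D, z - D)\<close> is a disjoint pair for every \<open>z\<close>. The value \<open>f x y\<close> is the
  transcript. Flipping coordinate \<open>k\<close> on one side stays within these inputs, and flipping it on both sides
  creates an intersection; \<open>E\<close> is the ownership of the coordinates other than \<open>k\<close>.
\<close>

lemma disjointness_advantage_le:
  fixes f :: "'u set \<Rightarrow> 'u set \<Rightarrow> 'l" and cost :: "'u set \<Rightarrow> 'u set \<Rightarrow> real"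
    and \<tau> :: real
  assumes fin: "finite U" and lam: "\<tau> > 0"
    and rect: "\<And>x y x' y'. f x y = f x' y' \<Longrightarrow> f x y' = f x y"
    and acc: "\<And>x y x' y'. f x y = f x' y' \<Longrightarrow> acc x y = acc x' y'"
    and ent: "\<And>D. D \<subseteq> U \<Longrightarrow>
      (\<Sum>z\<in>Pow U. ln (card (Pow U) / card {z'\<in>Pow U. f (z' \<inter> D) (z' - D) = f (z \<inter> D) (z - D)}))
      \<le> (\<Sum>z\<in>Pow U. cost (z \<inter> D) (z - D))"
  shows "(\<Sum>k\<in>U. \<Sum>E\<in>Pow (U - {k}). \<Sum>w\<in>Pow (U - {k}).
        of_bool (acc (w \<inter> E) (w - E)) - of_bool (acc (insert k (w \<inter> E)) (insert k (w - E))))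
    \<le> 6 / \<tau> * (\<Sum>D\<in>Pow U. \<Sum>z\<in>Pow U. cost (z \<inter> D) (z - D)) + 2 * \<tau> * card U * (2 ^ card U / 2)\<^sup>2"
proof -
  define \<Lambda> where "\<Lambda> = (\<lambda>(x, y). f x y) ` (Pow U \<times> Pow U)"
  have fL: "finite \<Lambda>" using fin by (simp add: \<Lambda>_def)
  have inL: "f x y \<in> \<Lambda>" if "x \<subseteq> U" "y \<subseteq> U" for x y using that by (force simp: \<Lambda>_def)
  \<comment> \<open>Acceptance is a function of the transcript, hence membership in a set of
    transcripts.\<close>
  define C where "C = {l\<in>\<Lambda>. \<exists>x y. f x y = l \<and> acc x y}"
  have accC: "acc x y \<longleftrightarrow> f x y \<in> C" if "x \<subseteq> U" "y \<subseteq> U" for x y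
  proof
    show "f x y \<in> C" if "acc x y" using that inL[OF \<open>x \<subseteq> U\<close> \<open>y \<subseteq> U\<close>] unfolding C_def by blast
    assume "f x y \<in> C"
    then obtain x' y' where "f x' y' = f x y" "acc x' y'" unfolding C_def by blast
    then show "acc x y" using acc[of x' y' x y] by simp
  qed
  define L where "L D l = {z\<in>Pow U. f (z \<inter> D) (z - D) = l}" for D l
  \<comment> \<open>For ownership \<open>D\<close>, this is the triangular discrimination between
    the transcript counts with coordinate \<open>k\<close> present and absent.\<close>
  define G where "G D k = (\<Sum>l\<in>\<Lambda>. (bias k (L D l))\<^sup>2 / card (L D l))" for D k
  define W where "W = (2::real) ^ card U / 2"
  \<comment> \<open>The level-one inequality in each transcript class controls all coordinates at
    once; summed over the classes, its right side is the entropy of the transcript,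
    unnormalised.\<close>
  have G_le: "(\<Sum>k\<in>U. G D k) \<le> 6 * (\<Sum>z\<in>Pow U. cost (z \<inter> D) (z - D))" if D: "D \<subseteq> U" for D
  proof -
    have "(\<Sum>k\<in>U. G D k) = (\<Sum>l\<in>\<Lambda>. \<Sum>k\<in>U. (bias k (L D l))\<^sup>2 / card (L D l))"
      unfolding G_def by (rule sum.swap)
    also have "\<dots> \<le> (\<Sum>l\<in>\<Lambda>. 6 * (card (L D l) * ln (2 ^ card U / card (L D l))))"
      by (intro sum_mono level_one_inequality fin) (auto simp: L_def)
    also have "\<dots> = 6 * (\<Sum>l\<in>\<Lambda>. \<Sum>z\<in>L D l. ln (2 ^ card U / card (L D l)))"
      by (simp add: sum_distrib_left)
    \<comment> \<open>Naming the class by the transcript of \<open>z\<close> makes the summand a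
      function of \<open>z\<close>, so the double sum regroups over \<open>Pow U\<close>.\<close>
    also have "(\<Sum>l\<in>\<Lambda>. \<Sum>z\<in>L D l. ln (2 ^ card U / card (L D l)))
      = (\<Sum>l\<in>\<Lambda>. \<Sum>z\<in>L D l. ln (2 ^ card U / card (L D (f (z \<inter> D) (z - D)))))"
      by (intro sum.cong refl) (auto simp: L_def)
    also have "\<dots> = (\<Sum>z\<in>Pow U. ln (2 ^ card U / card (L D (f (z \<inter> D) (z - D)))))"
      unfolding L_def by (subst sum.group) (use fin fL D in \<open>auto intro!: inL\<close>)
    also have "\<dots> \<le> (\<Sum>z\<in>Pow U. cost (z \<inter> D) (z - D))"
      using ent[OF D] fin by (simp add: L_def card_Pow)
    finally show ?thesis by simp
  qed
  have card_V: "real (card (Pow (U - {k}))) = W" if "k \<in> U" for k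
    unfolding W_def by (rule real_card_Pow_remove[OF fin that])
  have step: "(\<Sum>w\<in>Pow (U - {k}). of_bool (acc (w \<inter> E) (w - E))
        - of_bool (acc (insert k (w \<inter> E)) (insert k (w - E))))
      \<le> (G (insert k E) k + G E k) / \<tau> + 2 * \<tau> * W"
    if k: "k \<in> U" and E: "E \<in> Pow (U - {k})" for k E
  proof -
    define V where "V = U - {k}"
    have V: "finite V" "E \<subseteq> V" "k \<notin> V" "V \<subseteq> U" "k \<notin> E" using fin E by (auto simp: V_def)
    define i where "i b x = (if b then insert k x else x)" for b x
    have i_sub: "i b x \<subseteq> U" if "x \<subseteq> V" for b x using that k V by (auto simp: i_def)
    define p where "p u v l = real (card {w\<in>Pow V. f (i u (w \<inter> E)) (i v (w - E)) = l})" for u v l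
    have p_of: "p u v l = (\<Sum>w\<in>Pow V. of_bool (f (i u (w \<inter> E)) (i v (w - E)) = l))" for u v l
      unfolding p_def by (rule real_card_Collect_Pow[OF V(1)])
    \<comment> \<open>Each player's half is counted if some input of the other player yields
      \<open>l\<close>. By \<open>rect\<close>, two such halves together yield \<open>l\<close>, so
      the counts multiply; this gives the product condition for cut and paste.\<close>
    define \<alpha> where "\<alpha> u l = real (card {x\<in>Pow E. \<exists>y. f (i u x) y = l})" for u l
    define \<beta> where "\<beta> v l = real (card {y\<in>Pow (V - E). \<exists>x. f x (i v y) = l})" for v l
    have p_prod: "p u v l = \<alpha> u l * \<beta> v l" for u v l
    proof -
      have "bij_betw (\<lambda>w. (w \<inter> E, w - E)) {w\<in>Pow V. f (i u (w \<inter> E)) (i v (w - E)) = l}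
        ({x\<in>Pow E. \<exists>y. f (i u x) y = l} \<times> {y\<in>Pow (V - E). \<exists>x. f x (i v y) = l})"
        (is "bij_betw ?h ?M (?P \<times> ?Q)")
      proof (rule bij_betw_byWitness[where f' = "\<lambda>(x, y). x \<union> y"])
        show "?h ` ?M \<subseteq> ?P \<times> ?Q" by auto
        show "(\<lambda>(x, y). x \<union> y) ` (?P \<times> ?Q) \<subseteq> ?M"
        proof
          fix w assume "w \<in> (\<lambda>(x, y). x \<union> y) ` (?P \<times> ?Q)"
          then obtain x y x' y' where w: "w = x \<union> y" "x \<subseteq> E" "y \<subseteq> V - E"
            and e: "f (i u x) y' = l" "f x' (i v y) = l" by auto
          have "w \<inter> E = x" "w - E = y" "w \<subseteq> V" using w V(2) by auto
          moreover have "f (i u x) (i v y) = l" using rect[of "i u x" y' x' "i v y"] e by simp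
          ultimately show "w \<in> ?M" by simp
        qed
      qed (use V in auto)
      then show ?thesis unfolding p_def \<alpha>_def \<beta>_def
        by (simp add: bij_betw_same_card card_cartesian_product)
    qed
    have cV: "real (card (Pow V)) = W" using card_V[OF k] by (simp add: V_def)
    have p_sum: "sum (p u v) \<Lambda> = W" for u v
    proof -
      have "sum (p u v) \<Lambda> = (\<Sum>w\<in>Pow V. \<Sum>l\<in>\<Lambda>. of_bool (f (i u (w \<inter> E)) (i v (w - E)) = l))"
        unfolding p_of by (rule sum.swap)
      also have "\<dots> = (\<Sum>w\<in>Pow V. 1)"
      proof (intro sum.cong refl)
        fix w assume "w \<in> Pow V"
        then have "f (i u (w \<inter> E)) (i v (w - E)) \<in> \<Lambda>" by (intro inL i_sub) auto
        then show "(\<Sum>l\<in>\<Lambda>. of_bool (f (i u (w \<inter> E)) (i v (w - E)) = l)) = (1::real)"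
          using fL by (simp add: of_bool_def)
      qed
      finally show ?thesis using cV by simp
    qed
    have p_C: "(\<Sum>l\<in>C. p u v l) = (\<Sum>w\<in>Pow V. of_bool (acc (i u (w \<inter> E)) (i v (w - E))))" for u v
    proof -
      have "(\<Sum>l\<in>C. p u v l) = (\<Sum>w\<in>Pow V. \<Sum>l\<in>C. of_bool (f (i u (w \<inter> E)) (i v (w - E)) = l))"
        unfolding p_of by (rule sum.swap)
      also have "\<dots> = (\<Sum>w\<in>Pow V. of_bool (acc (i u (w \<inter> E)) (i v (w - E))))"
      proof (intro sum.cong refl)
        fix w assume "w \<in> Pow V"
        then have "acc (i u (w \<inter> E)) (i v (w - E)) \<longleftrightarrow> f (i u (w \<inter> E)) (i v (w - E)) \<in> C"
          by (intro accC i_sub) auto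
        moreover have "finite C" using fL by (simp add: C_def)
        ultimately show "(\<Sum>l\<in>C. of_bool (f (i u (w \<inter> E)) (i v (w - E)) = l))
          = (of_bool (acc (i u (w \<inter> E)) (i v (w - E))) :: real)"
          by (simp add: of_bool_def)
      qed
      finally show ?thesis .
    qed
    have L_split: "real (card (L D l)) = (\<Sum>w\<in>Pow V. of_bool (f (insert k w \<inter> D) (insert k w - D) = l))
        + (\<Sum>w\<in>Pow V. of_bool (f (w \<inter> D) (w - D) = l))"
      "bias k (L D l) = (\<Sum>w\<in>Pow V. of_bool (f (insert k w \<inter> D) (insert k w - D) = l))
        - (\<Sum>w\<in>Pow V. of_bool (f (w \<inter> D) (w - D) = l))" for D l
    proof -
      show "real (card (L D l)) = (\<Sum>w\<in>Pow V. of_bool (f (insert k w \<inter> D) (insert k w - D) = l))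
        + (\<Sum>w\<in>Pow V. of_bool (f (w \<inter> D) (w - D) = l))"
        unfolding L_def real_card_Collect_Pow[OF fin] V_def by (rule sum_Pow_split[OF fin k])
      have "bias k (L D l) = (\<Sum>z\<in>Pow U. of_bool (f (z \<inter> D) (z - D) = l) * (if k \<in> z then 1 else -1))"
        unfolding bias_def L_def using fin
        by (intro sum.mono_neutral_cong_left) auto
      also have "\<dots> = (\<Sum>w\<in>Pow V. of_bool (f (insert k w \<inter> D) (insert k w - D) = l))
        + (\<Sum>w\<in>Pow V. - of_bool (f (w \<inter> D) (w - D) = l))"
        unfolding sum_Pow_split[OF fin k] V_def
        by (intro arg_cong2[where f = "(+)"] sum.cong) auto
      finally show "bias k (L D l) = (\<Sum>w\<in>Pow V. of_bool (f (insert k w \<inter> D) (insert k w - D) = l))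
        - (\<Sum>w\<in>Pow V. of_bool (f (w \<inter> D) (w - D) = l))"
        by (simp add: sum_negf)
    qed
    have s1: "insert k w \<inter> insert k E = insert k (w \<inter> E)" "insert k w - insert k E = w - E"
      "w \<inter> insert k E = w \<inter> E" "w - insert k E = w - E" if "w \<in> Pow V" for w
      using that V by auto
    have s2: "insert k w \<inter> E = w \<inter> E" "insert k w - E = insert k (w - E)" for w
      using V by auto
    \<comment> \<open>Under ownership \<open>insert k E\<close>, flipping \<open>k\<close> in
      \<open>z\<close> changes the first player's input only; under \<open>E\<close>, in
      \<open>G2\<close>, the second player's only.\<close>
    have G1: "G (insert k E) k = (\<Sum>l\<in>\<Lambda>. (p True False l - p False False l)\<^sup>2 / (p True False l + p False False l))"
    proof -
      have "(\<Sum>w\<in>Pow V. of_bool (f (insert k w \<inter> insert k E) (insert k w - insert k E) = l)) = p True False l"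
        "(\<Sum>w\<in>Pow V. of_bool (f (w \<inter> insert k E) (w - insert k E) = l)) = p False False l" for l
        unfolding p_of by (intro sum.cong refl; simp only: s1 i_def if_True if_False)+
      then show ?thesis unfolding G_def L_split by simp
    qed
    have G2: "G E k = (\<Sum>l\<in>\<Lambda>. (p False True l - p False False l)\<^sup>2 / (p False True l + p False False l))"
      unfolding G_def L_split p_of by (simp add: i_def s2)
    have "(\<Sum>l\<in>C. p False False l - p True True l) \<le> (G (insert k E) k + G E k) / \<tau> + 2 * \<tau> * W"
      unfolding G1 G2
      by (rule hellinger_cut_and_paste[OF fL _ lam]) (use p_sum in \<open>auto simp: C_def p_prod \<alpha>_def \<beta>_def\<close>)
    then show ?thesis unfolding sum_subtractf p_C V_def by (simp add: i_def)
  qed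
  have "(\<Sum>k\<in>U. \<Sum>E\<in>Pow (U - {k}). \<Sum>w\<in>Pow (U - {k}).
        of_bool (acc (w \<inter> E) (w - E)) - of_bool (acc (insert k (w \<inter> E)) (insert k (w - E))))
    \<le> (\<Sum>k\<in>U. \<Sum>E\<in>Pow (U - {k}). (G (insert k E) k + G E k) / \<tau> + 2 * \<tau> * W)"
    by (intro sum_mono step)
  \<comment> \<open>As \<open>E\<close> ranges over the subsets of \<open>U - {k}\<close>, the sets
    \<open>insert k E\<close> and \<open>E\<close> together run through every
    \<open>D \<subseteq> U\<close> once.\<close>
  also have "\<dots> = (\<Sum>k\<in>U. (\<Sum>D\<in>Pow U. G D k) / \<tau> + 2 * \<tau> * W * W)"
    by (intro sum.cong refl)
      (simp add: sum.distrib sum_Pow_split[OF fin] card_V add_divide_distrib sum_divide_distrib)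
  also have "\<dots> = (\<Sum>D\<in>Pow U. \<Sum>k\<in>U. G D k) / \<tau> + 2 * \<tau> * card U * W\<^sup>2"
    by (subst sum.swap) (simp add: sum.distrib sum_divide_distrib power2_eq_square)
  also have "\<dots> \<le> (\<Sum>D\<in>Pow U. 6 * (\<Sum>z\<in>Pow U. cost (z \<inter> D) (z - D))) / \<tau> + 2 * \<tau> * card U * W\<^sup>2"
    using lam by (intro add_right_mono divide_right_mono sum_mono G_le) auto
  finally show ?thesis unfolding W_def by (simp add: sum_distrib_left sum_divide_distrib)
qed

section \<open>Reduction to stable roommates\<close>

lemma prefers_iff_takeWhile:
  assumes "distinct (P a)" "c \<in> set (P a)"
  shows "prefers P a b c \<longleftrightarrow> b \<in> set (takeWhile (\<lambda>d. d \<noteq> c) (P a))"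
proof -
  obtain us vs where P: "P a = us @ c # vs" "c \<notin> set us"
    using split_list_first[OF assms(2)] by blast
  have tw: "takeWhile (\<lambda>d. d \<noteq> c) (P a) = us"
    using P by (simp add: takeWhile_append)
  have cpos: "j = length us" if "j < length (P a)" "P a ! j = c" for j
    using that assms(1) P nth_eq_iff_index_eq[of "P a" j "length us"] by auto
  show ?thesis
  proof
    assume "prefers P a b c"
    then obtain i j where ij: "i < j" "j < length (P a)" "P a ! i = b" "P a ! j = c"
      by (auto simp: prefers_def)
    have "i < length us" using cpos[OF ij(2,4)] ij(1) by simp
    moreover from this have "us ! i = b" using ij(3) by (simp add: P(1) nth_append)
    ultimately have "b \<in> set us" by auto
    then show "b \<in> set (takeWhile (\<lambda>d. d \<noteq> c) (P a))" unfolding tw .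
  next
    assume "b \<in> set (takeWhile (\<lambda>d. d \<noteq> c) (P a))"
    then obtain i where "i < length us" "us ! i = b" unfolding tw by (auto simp: in_set_conv_nth)
    then show "prefers P a b c" unfolding prefers_def
      by (intro exI[of _ i] exI[of _ "length us"]) (auto simp: P nth_append)
  qed
qed

lemma partner_eq:
  assumes "matching S M" "{a, b} \<in> M" "a \<noteq> b"
  shows "partner M a = b"
  unfolding partner_def
proof (rule the_equality)
  fix c assume c: "c \<noteq> a \<and> {a, c} \<in> M"
  have "disjoint M" using assms by (simp add: matching_def partition_on_def)
  then have "{a, c} = {a, b}" using c assms(2) by (auto dest: disjointD)
  then show "c = b" using c assms(3) by (auto simp: doubleton_eq_iff)
qed (use assms in auto)

lemma partner_in_matching:
  assumes "matching S M" "a \<in> S"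
  shows "partner M a \<noteq> a" "{a, partner M a} \<in> M" "partner M a \<in> S" "partner M (partner M a) = a"
proof -
  obtain e where e: "e \<in> M" "a \<in> e"
    using assms by (auto simp: matching_def partition_on_def)
  then have "card e = 2" using assms by (simp add: matching_def)
  then obtain b where b: "e = {a, b}" "b \<noteq> a" using e(2) by (auto simp: card_2_iff)
  have "partner M a = b" using partner_eq[OF assms(1)] e b by auto
  moreover have "partner M b = a" using partner_eq[OF assms(1), of b a] e b by (auto simp: insert_commute)
  moreover have "b \<in> S" using e b assms by (auto simp: matching_def partition_on_def)
  ultimately show "partner M a \<noteq> a" "{a, partner M a} \<in> M" "partner M a \<in> S" "partner M (partner M a) = a"
    using e b by auto
qed

text \<open>Lists are total, so a partner that is neither \<open>b\<close> nor before
  \<open>b\<close> comes after \<open>b\<close>. The \<open>takeWhile\<close> form makes each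
  constraint depend on an initial segment of a list only.\<close>

lemma stable_matchingD:
  assumes "sr_instance S P" "stable_matching S P M" "a \<in> S" "b \<in> S" "a \<noteq> b"
  shows "partner M a = b \<or> partner M a \<in> set (takeWhile (\<lambda>d. d \<noteq> b) (P a))
    \<or> partner M b \<in> set (takeWhile (\<lambda>d. d \<noteq> a) (P b))"
proof (rule ccontr)
  assume neg: "\<not> ?thesis"
  have M: "matching S M" using assms by (simp add: stable_matching_def)
  have pref: "prefers P a b (partner M a)"
    if "a \<in> S" "b \<in> S" "a \<noteq> b" "partner M a \<noteq> b" "partner M a \<notin> set (takeWhile (\<lambda>d. d \<noteq> b) (P a))" for a b
  proof -
    have P: "distinct (P a)" "set (P a) = S - {a}" using assms that by (auto simp: sr_instance_def)
    have "b \<in> set (P a)" using P(2) that(2,3) by simp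
    then obtain us vs where us: "P a = us @ b # vs" "b \<notin> set us"
      using split_list_first[of b "P a"] by blast
    have "partner M a \<in> set (P a)" using partner_in_matching[OF M that(1)] P by auto
    moreover have "takeWhile (\<lambda>d. d \<noteq> b) (P a) = us"
      using us by (simp add: takeWhile_append)
    ultimately have "partner M a \<in> set vs" using us that by auto
    then obtain i where "i < length vs" "vs ! i = partner M a" by (auto simp: in_set_conv_nth)
    then show ?thesis unfolding prefers_def us(1)
      by (intro exI[of _ "length us"] exI[of _ "Suc (length us + i)"]) (auto simp: nth_append)
  qed
  have "partner M b \<noteq> a" using neg partner_in_matching(4)[OF M assms(4)] by auto
  then have "blocking_pair S P M a b" unfolding blocking_pair_def
    using neg assms(3-5) pref[of a b] pref[of b a] partner_eq[OF M] by auto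
  then show False using assms(2) by (auto simp: stable_matching_def)
qed

text \<open>The order is a fixed choice depending on the set alone, so a list built this way changes
  only when its set does.\<close>

definition list_of :: "'a set \<Rightarrow> 'a list" where
  "list_of X = (SOME xs. set xs = X \<and> distinct xs)"

lemma list_of:
  assumes "finite X"
  shows "set (list_of X) = X" "distinct (list_of X)"
  using someI_ex[OF finite_distinct_list[OF assms]] by (auto simp: list_of_def)

lemma takeWhile_neq_append:
  "b \<in> set xs \<Longrightarrow> takeWhile (\<lambda>d. d \<noteq> b) (xs @ ys) = takeWhile (\<lambda>d. d \<noteq> b) xs"
  by (rule takeWhile_append1) auto

lemma takeWhile_neq_snoc:
  "b \<notin> set xs \<Longrightarrow> takeWhile (\<lambda>d. d \<noteq> b) (xs @ [b]) = xs"
  by (subst takeWhile_append2) auto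

text \<open>
  The intended matching pairs \<open>v\<close> with \<open>\<sigma> v\<close>. Agents in \<open>A\<close> and \<open>B\<close> hold the two inputs. An agent
  \<open>a \<in> A\<close> that leaves \<open>\<sigma> a\<close> for some \<open>b \<in> B\<close> makes \<open>\<sigma> a\<close> take \<open>g\<close> away from \<open>\<sigma> g\<close>, and then \<open>\<sigma> g\<close>,
  \<open>h\<close>, \<open>\<sigma> h\<close> prefer each other cyclically, which excludes stability.
\<close>

locale roommates_gadget =
  fixes S X A B :: "'a set" and \<sigma> :: "'a \<Rightarrow> 'a" and g h :: 'a
  assumes finite_S: "finite S"
    and sigma_in: "v \<in> S \<Longrightarrow> \<sigma> v \<in> S"
    and sigma_sigma: "v \<in> S \<Longrightarrow> \<sigma> (\<sigma> v) = v"
    and sigma_X: "v \<in> S \<Longrightarrow> \<sigma> v \<in> X \<longleftrightarrow> v \<notin> X"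
    and X: "X \<subseteq> S" "A \<subseteq> X" "B \<subseteq> X" "A \<inter> B = {}"
    and gh: "g \<in> X" "h \<in> X" "g \<noteq> h" "g \<notin> A" "g \<notin> B" "h \<notin> A" "h \<notin> B"
begin

text \<open>These initial segments decide stability. The first input enters the lists of
  \<open>A\<close> only, the second those of \<open>B\<close> only. \<open>g\<close> would rather
  have a partner of an agent in \<open>A\<close> than \<open>\<sigma> g\<close>; once
  \<open>g\<close> is lost to \<open>\<sigma> g\<close>, the cycle is: \<open>\<sigma> g\<close>
  prefers \<open>h\<close> to \<open>\<sigma> h\<close>, \<open>h\<close> prefers
  \<open>\<sigma> h\<close> to \<open>\<sigma> g\<close>, and \<open>\<sigma> h\<close> prefers
  \<open>\<sigma> g\<close> to \<open>h\<close>.\<close>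

definition top_choices :: "('a \<times> 'a) set \<Rightarrow> ('a \<times> 'a) set \<Rightarrow> 'a \<Rightarrow> 'a list" where
  "top_choices x y v =
    (if v \<in> A then list_of {b\<in>B. (v, b) \<in> x} @ [\<sigma> v]
     else if v \<in> B then list_of {a\<in>A. (a, v) \<in> y} @ [\<sigma> v]
     else if v \<in> \<sigma> ` A then [\<sigma> v, g]
     else if v = g then list_of (\<sigma> ` A) @ [\<sigma> g]
     else if v = \<sigma> g then [g, h, \<sigma> h]
     else if v = h then [\<sigma> h, \<sigma> g]
     else if v = \<sigma> h then [\<sigma> g, h]
     else [\<sigma> v])"

definition profile_of :: "('a \<times> 'a) set \<Rightarrow> ('a \<times> 'a) set \<Rightarrow> 'a profile" where
  "profile_of x y v = top_choices x y v @ list_of (S - {v} - set (top_choices x y v))"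

lemma finite_AB: "finite A" "finite B"
  using X finite_S by (auto intro: finite_subset)

lemma set_lists [simp]:
  "set (list_of {b\<in>B. (v, b) \<in> x}) = {b\<in>B. (v, b) \<in> x}" "distinct (list_of {b\<in>B. (v, b) \<in> x})"
  "set (list_of {a\<in>A. (a, v) \<in> y}) = {a\<in>A. (a, v) \<in> y}" "distinct (list_of {a\<in>A. (a, v) \<in> y})"
  "set (list_of (\<sigma> ` A)) = \<sigma> ` A" "distinct (list_of (\<sigma> ` A))"
  using finite_AB by (simp_all add: list_of)

lemma in_S: "v \<in> X \<Longrightarrow> v \<in> S" "v \<in> A \<Longrightarrow> v \<in> S" "v \<in> B \<Longrightarrow> v \<in> S" "g \<in> S" "h \<in> S" "\<sigma> g \<in> S" "\<sigma> h \<in> S"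
  "v \<in> A \<Longrightarrow> \<sigma> v \<in> S"
  using X gh sigma_in by auto

lemma sigma_not_X: "v \<in> X \<Longrightarrow> \<sigma> v \<notin> X"
  using sigma_X in_S by blast

lemma sigma_eq_iff: "v \<in> S \<Longrightarrow> w \<in> S \<Longrightarrow> \<sigma> v = \<sigma> w \<longleftrightarrow> v = w"
  by (metis sigma_sigma)

lemma sigma_ne: "v \<in> S \<Longrightarrow> \<sigma> v \<noteq> v"
  using sigma_X by metis

text \<open>Membership in \<open>X\<close> separates \<open>A\<close>, \<open>B\<close>,
  \<open>g\<close>, \<open>h\<close> from their images under \<open>\<sigma>\<close>, and
  injectivity of \<open>\<sigma>\<close> separates these images from each other.\<close>

lemma gadget_agents:
  "\<sigma> (\<sigma> g) = g" "\<sigma> (\<sigma> h) = h"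
  "\<sigma> g \<noteq> g" "\<sigma> h \<noteq> h" "\<sigma> g \<noteq> h" "\<sigma> h \<noteq> g" "\<sigma> g \<noteq> \<sigma> h"
  "g \<noteq> \<sigma> g" "h \<noteq> \<sigma> h" "h \<noteq> \<sigma> g" "g \<noteq> \<sigma> h" "\<sigma> h \<noteq> \<sigma> g" "h \<noteq> g"
  "\<sigma> g \<notin> A" "\<sigma> g \<notin> B" "\<sigma> h \<notin> A" "\<sigma> h \<notin> B"
  "g \<notin> \<sigma> ` A" "h \<notin> \<sigma> ` A" "\<sigma> g \<notin> \<sigma> ` A" "\<sigma> h \<notin> \<sigma> ` A"
proof -
  have "\<sigma> g \<notin> X" "\<sigma> h \<notin> X" using sigma_not_X gh(1,2) by auto
  then show "\<sigma> g \<noteq> g" "\<sigma> h \<noteq> h" "\<sigma> g \<noteq> h" "\<sigma> h \<noteq> g" "g \<noteq> \<sigma> g" "h \<noteq> \<sigma> h" "h \<noteq> \<sigma> g" "g \<noteq> \<sigma> h"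
    "\<sigma> g \<notin> A" "\<sigma> g \<notin> B" "\<sigma> h \<notin> A" "\<sigma> h \<notin> B"
    using gh(1,2) X(2,3) by auto
  show "\<sigma> (\<sigma> g) = g" "\<sigma> (\<sigma> h) = h" using sigma_sigma in_S by auto
  show "\<sigma> g \<noteq> \<sigma> h" "\<sigma> h \<noteq> \<sigma> g" "h \<noteq> g" using gh(3) sigma_eq_iff in_S(4,5) by auto
  show "g \<notin> \<sigma> ` A" "h \<notin> \<sigma> ` A" using sigma_not_X X(2) gh(1,2) by auto
  show "\<sigma> g \<notin> \<sigma> ` A" "\<sigma> h \<notin> \<sigma> ` A"
    using sigma_eq_iff[OF in_S(4)] sigma_eq_iff[OF in_S(5)] in_S(2) gh(4,6) by (metis imageE)+
qed

lemma A_agents: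
  assumes "v \<in> A"
  shows "\<sigma> v \<notin> A" "\<sigma> v \<notin> B" "\<sigma> (\<sigma> v) = v" "v \<notin> \<sigma> ` A"
    "\<sigma> v \<noteq> g" "\<sigma> v \<noteq> \<sigma> g" "\<sigma> v \<noteq> h" "\<sigma> v \<noteq> \<sigma> h" "v \<noteq> g"
proof -
  have v: "v \<in> X" "v \<in> S" "\<sigma> v \<notin> X" using assms X sigma_not_X by auto
  show "\<sigma> v \<notin> A" "\<sigma> v \<notin> B" "\<sigma> v \<noteq> g" "\<sigma> v \<noteq> h" "v \<noteq> g" using v assms X gh by auto
  show "\<sigma> (\<sigma> v) = v" using v sigma_sigma by simp
  show "v \<notin> \<sigma> ` A" using v sigma_not_X X(2) by auto
  show "\<sigma> v \<noteq> \<sigma> g" "\<sigma> v \<noteq> \<sigma> h" using assms gh sigma_eq_iff[OF v(2)] in_S(4,5) by auto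
qed

lemma B_agents:
  assumes "v \<in> B"
  shows "v \<notin> A" "\<sigma> v \<notin> A" "\<sigma> v \<notin> B" "\<sigma> (\<sigma> v) = v" "v \<notin> \<sigma> ` A" "\<sigma> v \<notin> \<sigma> ` A"
    "\<sigma> v \<noteq> g" "\<sigma> v \<noteq> \<sigma> g" "\<sigma> v \<noteq> h" "\<sigma> v \<noteq> \<sigma> h"
proof -
  have v: "v \<in> X" "v \<in> S" "\<sigma> v \<notin> X" using assms X sigma_not_X by auto
  show "v \<notin> A" "\<sigma> v \<notin> A" "\<sigma> v \<notin> B" "\<sigma> v \<noteq> g" "\<sigma> v \<noteq> h" using v assms X gh by auto
  show "\<sigma> (\<sigma> v) = v" using v sigma_sigma by simp
  show "v \<notin> \<sigma> ` A" using v sigma_not_X X(2) by auto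
  show "\<sigma> v \<notin> \<sigma> ` A" using assms X(4) sigma_eq_iff[OF v(2)] in_S(2) by (metis IntI empty_iff imageE)
  show "\<sigma> v \<noteq> \<sigma> g" "\<sigma> v \<noteq> \<sigma> h" using assms gh sigma_eq_iff[OF v(2)] in_S(4,5) by auto
qed

lemma top_choices_simps:
  "v \<in> A \<Longrightarrow> top_choices x y v = list_of {b\<in>B. (v, b) \<in> x} @ [\<sigma> v]"
  "v \<in> B \<Longrightarrow> top_choices x y v = list_of {a\<in>A. (a, v) \<in> y} @ [\<sigma> v]"
  "v \<in> A \<Longrightarrow> top_choices x y (\<sigma> v) = [v, g]"
  "v \<in> B \<Longrightarrow> top_choices x y (\<sigma> v) = [v]"
  "top_choices x y g = list_of (\<sigma> ` A) @ [\<sigma> g]"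
  "top_choices x y (\<sigma> g) = [g, h, \<sigma> h]"
  "top_choices x y h = [\<sigma> h, \<sigma> g]"
  "top_choices x y (\<sigma> h) = [\<sigma> g, h]"
  by (simp_all add: top_choices_def gadget_agents A_agents B_agents gh)

lemma top_choices_valid:
  assumes "v \<in> S"
  shows "distinct (top_choices x y v)" "set (top_choices x y v) \<subseteq> S - {v}" "\<sigma> v \<in> set (top_choices x y v)"
proof -
  consider "v \<in> A" | "v \<in> B" | "v \<in> \<sigma> ` A" | "v = g" | "v = \<sigma> g" | "v = h" | "v = \<sigma> h"
    | "v \<notin> A" "v \<notin> B" "v \<notin> \<sigma> ` A" "v \<noteq> g" "v \<noteq> \<sigma> g" "v \<noteq> h" "v \<noteq> \<sigma> h"
    by blast
  then have "distinct (top_choices x y v) \<and> set (top_choices x y v) \<subseteq> S - {v}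
    \<and> \<sigma> v \<in> set (top_choices x y v)"
  proof cases
    case 1
    then show ?thesis using sigma_in[OF assms] sigma_ne[OF assms] A_agents(2) in_S(3) X(4)
      by (auto simp: top_choices_simps(1))
  next
    case 2
    then show ?thesis using sigma_in[OF assms] sigma_ne[OF assms] B_agents(2) in_S(2) X(4)
      by (auto simp: top_choices_simps(2))
  next
    case 3
    then obtain a where a: "v = \<sigma> a" "a \<in> A" by blast
    then show ?thesis using sigma_ne[of a] A_agents(3,5,9)[of a] in_S(2)[of a] in_S(4)
      by (auto simp: top_choices_simps(3))
  next
    case 8
    then show ?thesis using sigma_in[OF assms] sigma_ne[OF assms] by (simp add: top_choices_def)
  qed (use in_S gadget_agents gh in \<open>auto simp: top_choices_simps(5-8)\<close>)
  then show "distinct (top_choices x y v)" "set (top_choices x y v) \<subseteq> S - {v}"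
    "\<sigma> v \<in> set (top_choices x y v)" by blast+
qed

lemma sr_instance_profile_of: "sr_instance S (profile_of x y)"
  unfolding sr_instance_def profile_of_def
proof (intro conjI ballI finite_S)
  fix v assume "v \<in> S"
  note * = top_choices_valid[OF this, of x y]
  have "finite (S - {v} - set (top_choices x y v))" using finite_S by simp
  note list_of[OF this]
  with * show "distinct (top_choices x y v @ list_of (S - {v} - set (top_choices x y v)))"
    "set (top_choices x y v @ list_of (S - {v} - set (top_choices x y v))) = S - {v}"
    by auto
qed

section \<open>Agents ranked above a given one in the gadget\<close>

definition better :: "('a \<times> 'a) set \<Rightarrow> ('a \<times> 'a) set \<Rightarrow> 'a \<Rightarrow> 'a \<Rightarrow> 'a set" where
  "better x y v w = set (takeWhile (\<lambda>d. d \<noteq> w) (profile_of x y v))"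

lemma better_eq:
  "w \<in> set (top_choices x y v) \<Longrightarrow> better x y v w = set (takeWhile (\<lambda>d. d \<noteq> w) (top_choices x y v))"
  by (simp add: better_def profile_of_def takeWhile_neq_append)

lemma better_simps:
  "v \<in> A \<Longrightarrow> better x y v (\<sigma> v) = {b\<in>B. (v, b) \<in> x}"
  "v \<in> B \<Longrightarrow> better x y v (\<sigma> v) = {a\<in>A. (a, v) \<in> y}"
  "v \<in> A \<Longrightarrow> better x y (\<sigma> v) g = {v}"
  "v \<in> B \<Longrightarrow> better x y (\<sigma> v) v = {}"
  "better x y g (\<sigma> g) = \<sigma> ` A"
  "better x y (\<sigma> g) g = {}"
  "better x y (\<sigma> g) h = {g}"
  "better x y (\<sigma> g) (\<sigma> h) = {g, h}"
  "better x y h (\<sigma> g) = {\<sigma> h}"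
  "better x y h (\<sigma> h) = {}"
  "better x y (\<sigma> h) (\<sigma> g) = {}"
  "better x y (\<sigma> h) h = {\<sigma> g}"
  by (simp_all add: better_eq top_choices_simps takeWhile_neq_snoc gadget_agents A_agents
    B_agents gh insert_commute)

text \<open>The order inside a \<open>list_of\<close> block is unspecified, so what precedes one of
  its entries is only known to lie in the block.\<close>

lemma better_subset:
  "v \<in> A \<Longrightarrow> b \<in> B \<Longrightarrow> (v, b) \<in> x \<Longrightarrow> better x y v b \<subseteq> B"
  "v \<in> B \<Longrightarrow> a \<in> A \<Longrightarrow> (a, v) \<in> y \<Longrightarrow> better x y v a \<subseteq> A"
  "a \<in> A \<Longrightarrow> better x y g (\<sigma> a) \<subseteq> \<sigma> ` A"
  by (auto simp: better_eq top_choices_simps takeWhile_neq_append dest!: set_takeWhileD)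

lemma better_sigma_other:
  assumes "v \<in> S" "v \<notin> A" "v \<notin> B" "v \<noteq> g" "v \<noteq> \<sigma> h"
  shows "better x y v (\<sigma> v) = {}"
  using assms by (auto simp: better_eq top_choices_def gadget_agents(1,2))

text \<open>If \<open>g\<close> is matched to \<open>\<sigma> g\<close>, every agent of
  \<open>A\<close> and then \<open>b\<close> is forced to its intended partner, and
  \<open>a\<close>, \<open>b\<close> block. Otherwise the cyclic triple has no stable
  arrangement.\<close>

lemma not_solvable_of_common:
  assumes ab: "a \<in> A" "b \<in> B" "(a, b) \<in> x" "(a, b) \<in> y"
  shows "\<not> solvable S (profile_of x y)"
proof
  assume "solvable S (profile_of x y)"
  then obtain M where M: "stable_matching S (profile_of x y) M" by (auto simp: solvable_def)
  then have mM: "matching S M" by (simp add: stable_matching_def)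
  define \<pi> where "\<pi> = partner M"
  have st: "\<pi> v = w \<or> \<pi> v \<in> better x y v w \<or> \<pi> w \<in> better x y w v"
    if "v \<in> S" "w \<in> S" "v \<noteq> w" for v w
    using stable_matchingD[OF sr_instance_profile_of M that] by (simp add: \<pi>_def better_def)
  have pp: "\<pi> (\<pi> v) = v" if "v \<in> S" for v
    using partner_in_matching[OF mM that] by (simp add: \<pi>_def)
  show False
  proof (cases "\<pi> g = \<sigma> g")
    case True
    \<comment> \<open>With \<open>g\<close> taken by \<open>\<sigma> g\<close>, which it likes less
      than \<open>\<sigma> a'\<close>, only having its first choice \<open>a'\<close> keeps
      \<open>\<sigma> a'\<close> from blocking with \<open>g\<close>.\<close>
    have pA: "\<pi> a' = \<sigma> a'" if "a' \<in> A" for a'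
    proof -
      have "\<pi> (\<sigma> a') = g \<or> \<pi> (\<sigma> a') \<in> better x y (\<sigma> a') g \<or> \<pi> g \<in> better x y g (\<sigma> a')"
        using that in_S(4,8) A_agents(5) by (intro st) auto
      moreover have "\<pi> (\<sigma> a') \<noteq> g" using True that pp[of "\<sigma> a'"] in_S(8) A_agents(6) by metis
      moreover have "\<pi> g \<notin> better x y g (\<sigma> a')" using True better_subset(3)[OF that] gadget_agents(20) by auto
      ultimately have "\<pi> (\<sigma> a') = a'" using that by (simp add: better_simps)
      then show ?thesis using pp[of "\<sigma> a'"] in_S that by simp
    qed
    have pb: "\<pi> b = \<sigma> b"
    proof -
      \<comment> \<open>\<open>\<sigma> b\<close> ranks \<open>b\<close> first, and \<open>b\<close>
        prefers only agents of \<open>A\<close> to \<open>\<sigma> b\<close>, all of which are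
        taken.\<close>
      have "\<pi> (\<sigma> b) = b \<or> \<pi> (\<sigma> b) \<in> better x y (\<sigma> b) b \<or> \<pi> b \<in> better x y b (\<sigma> b)"
        using ab(2) in_S(3) sigma_in sigma_ne by (intro st) auto
      moreover have "\<pi> b \<notin> A" using pA[of "\<pi> b"] pp[OF in_S(3)[OF ab(2)]] B_agents(5)[OF ab(2)] by auto
      ultimately have "\<pi> (\<sigma> b) = b" using ab by (simp add: better_simps)
      then show ?thesis using pp[of "\<sigma> b"] in_S(3) sigma_in ab by simp
    qed
    have "\<pi> a = b \<or> \<pi> a \<in> better x y a b \<or> \<pi> b \<in> better x y b a"
      using ab(1,2) in_S(2,3) X(4) by (intro st) auto
    then show False
      using pA[OF ab(1)] pb better_subset(1)[OF ab(1-3), of y] better_subset(2)[OF ab(2,1,4), of x]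
        A_agents(2)[OF ab(1)] B_agents(2)[OF ab(2)] ab(2) by auto
  next
    case False
    have "\<pi> (\<sigma> g) \<noteq> g" using False pp in_S by metis
    \<comment> \<open>Each pair of the triple yields a disjunction of two of the triple's three
      possible matches. The three disjunctions force two of these matches, but any two share an
      agent.\<close>
    have "\<pi> (\<sigma> g) = h \<or> \<pi> (\<sigma> g) \<in> better x y (\<sigma> g) h \<or> \<pi> h \<in> better x y h (\<sigma> g)"
      using in_S(4-7) gadget_agents(3-13) by (intro st) auto
    with \<open>\<pi> (\<sigma> g) \<noteq> g\<close> have 1: "\<pi> (\<sigma> g) = h \<or> \<pi> h = \<sigma> h" by (simp add: better_simps)
    have "\<pi> h = \<sigma> h \<or> \<pi> h \<in> better x y h (\<sigma> h) \<or> \<pi> (\<sigma> h) \<in> better x y (\<sigma> h) h"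
      using in_S(4-7) gadget_agents(3-13) by (intro st) auto
    then have 2: "\<pi> h = \<sigma> h \<or> \<pi> (\<sigma> h) = \<sigma> g" by (simp add: better_simps)
    have "\<pi> (\<sigma> h) = \<sigma> g \<or> \<pi> (\<sigma> h) \<in> better x y (\<sigma> h) (\<sigma> g) \<or> \<pi> (\<sigma> g) \<in> better x y (\<sigma> g) (\<sigma> h)"
      using in_S(4-7) gadget_agents(3-13) by (intro st) auto
    with \<open>\<pi> (\<sigma> g) \<noteq> g\<close> have 3: "\<pi> (\<sigma> h) = \<sigma> g \<or> \<pi> (\<sigma> g) = h" by (simp add: better_simps)
    have "\<not> (\<pi> (\<sigma> g) = h \<and> \<pi> h = \<sigma> h)"
      using pp[of "\<sigma> g"] in_S(6) gadget_agents(7) by auto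
    moreover have "\<not> (\<pi> h = \<sigma> h \<and> \<pi> (\<sigma> h) = \<sigma> g)"
      using pp[of h] in_S(5) gadget_agents(5) by auto
    moreover have "\<not> (\<pi> (\<sigma> h) = \<sigma> g \<and> \<pi> (\<sigma> g) = h)"
      using pp[of "\<sigma> h"] in_S(7) gadget_agents(4) by auto
    ultimately show False using 1 2 3 by blast
  qed
qed

text \<open>The intended matching is stable. The only wishes to leave it are those of
  \<open>A\<close> and \<open>B\<close> given by the inputs, of \<open>g\<close> for partners of
  \<open>A\<close>, and of \<open>\<sigma> h\<close> for \<open>\<sigma> g\<close>; the last two are
  not returned, and the first are mutual only on \<open>x \<inter> y\<close>.\<close>

lemma solvable_of_disjoint:
  assumes "x \<inter> y = {}"
  shows "solvable S (profile_of x y)"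
proof -
  define M where "M = (\<lambda>v. {v, \<sigma> v}) ` S"
  have "partition_on S M" unfolding partition_on_def
  proof (intro conjI)
    show "disjoint M"
      by (rule disjointI) (auto simp: M_def sigma_sigma sigma_eq_iff)
  qed (auto simp: M_def sigma_in)
  then have M: "matching S M" using sigma_ne by (auto simp: matching_def M_def card_2_iff)
  have part: "partner M v = \<sigma> v" if "v \<in> S" for v
    using that sigma_ne[OF that] by (intro partner_eq[OF M]) (auto simp: M_def)
  have "\<not> blocking_pair S (profile_of x y) M a b" for a b
  proof
    assume bp: "blocking_pair S (profile_of x y) M a b"
    then have S: "a \<in> S" "b \<in> S" by (auto simp: blocking_pair_def)
    have *: "w \<in> better x y v (\<sigma> v)" if "prefers (profile_of x y) v w (partner M v)" "v \<in> S" for v w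
    proof -
      have "distinct (profile_of x y v)" "\<sigma> v \<in> set (profile_of x y v)"
        using sr_instance_profile_of[of x y] that sigma_in sigma_ne by (auto simp: sr_instance_def)
      from prefers_iff_takeWhile[of "profile_of x y" v, OF this] that show ?thesis by (simp add: better_def part)
    qed
    have b: "b \<in> better x y a (\<sigma> a)" "a \<in> better x y b (\<sigma> b)"
      using bp S * by (auto simp: blocking_pair_def)
    have mem: "v \<in> A \<and> w \<in> B \<and> (v, w) \<in> x \<or> v \<in> B \<and> w \<in> A \<and> (w, v) \<in> y
        \<or> v = g \<and> w \<in> \<sigma> ` A \<or> v = \<sigma> h \<and> w = \<sigma> g"
      if w: "w \<in> better x y v (\<sigma> v)" "v \<in> S" for v w
    proof -
      consider "v \<in> A" | "v \<in> B" | "v = g" | "v = \<sigma> h" using better_sigma_other[of v x y] w by blast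
      then show ?thesis
        by cases (use w in \<open>simp_all add: better_simps gadget_agents(1,2)\<close>)
    qed
    have "A \<inter> \<sigma> ` A = {}" "B \<inter> \<sigma> ` A = {}" using A_agents(4) B_agents(5) by blast+
    note dis = this and m2 = mem[OF b(2) S(2)]
    from mem[OF b(1) S(1)] show False
    proof (elim disjE conjE)
      assume "a \<in> A" "b \<in> B" "(a, b) \<in> x"
      then show False using m2 X(4) gh(5) gadget_agents(17) assms by auto
    next
      assume "a \<in> B" "b \<in> A" "(b, a) \<in> y"
      then show False using m2 X(4) gh(4) gadget_agents(16) assms by auto
    next
      assume "a = g" "b \<in> \<sigma> ` A"
      then show False using m2 dis gadget_agents(18,21) by blast
    next
      assume "a = \<sigma> h" "b = \<sigma> g"
      then show False using m2 gadget_agents by simp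
    qed
  qed
  then show ?thesis using M by (auto simp: solvable_def stable_matching_def)
qed

text \<open>Lets \<open>trace_rectangle\<close> apply: once \<open>A\<close> and \<open>B\<close>
  lie on different sides, each side's lists depend on one input only.\<close>

lemma profile_of_cong:
  "v \<notin> B \<Longrightarrow> profile_of x y v = profile_of x y' v"
  "v \<notin> A \<Longrightarrow> profile_of x y v = profile_of x' y v"
  by (simp_all add: profile_of_def top_choices_def)

end

text \<open>Pad \<open>A\<close> and \<open>B\<close> with at least two further agents, among them
  \<open>g\<close> and \<open>h\<close>, to exactly half of \<open>S\<close>; any bijection onto the
  other half serves as \<open>\<sigma>\<close>.\<close>

lemma roommates_gadget_exists:
  assumes "finite S" "even (card S)" "A \<subseteq> S" "B \<subseteq> S" "A \<inter> B = {}" "2 * (card A + card B) + 4 \<le> card S"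
  shows "\<exists>X \<sigma> g h. roommates_gadget S X A B \<sigma> g h"
proof -
  have fin: "finite A" "finite B" using assms finite_subset by auto
  have cAB: "card (A \<union> B) = card A + card B" using fin assms by (simp add: card_Un_disjoint)
  have "card S - (card A + card B) = card (S - (A \<union> B))"
    using assms fin cAB by (subst card_Diff_subset) auto
  then have "card S div 2 - (card A + card B) \<le> card (S - (A \<union> B))" by linarith
  then obtain R where R: "R \<subseteq> S - (A \<union> B)" "card R = card S div 2 - (card A + card B)" "finite R"
    using obtain_subset_with_card_n by metis
  have half: "card A + card B + 2 \<le> card S div 2" using assms(6) by simp
  then have "2 \<le> card R" using R(2) by simp
  then obtain G where "G \<subseteq> R" "card G = 2" using obtain_subset_with_card_n by metis
  then obtain g h where gh: "g \<in> R" "h \<in> R" "g \<noteq> h" by (auto simp: card_2_iff)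
  define X where "X = A \<union> B \<union> R"
  have X: "X \<subseteq> S" "finite X" using R assms fin by (auto simp: X_def)
  have "card X = card (A \<union> B) + card R" unfolding X_def using R fin by (intro card_Un_disjoint) auto
  then have cX: "card X = card S div 2" using cAB R(2) half by simp
  have "card (S - X) = card S - card X" using X by (simp add: card_Diff_subset)
  then have "card (S - X) = card X" using cX assms(2) by auto
  then obtain f where f: "bij_betw f X (S - X)"
    using X assms finite_same_card_bij[of X "S - X"] by auto
  define \<sigma> where "\<sigma> v = (if v \<in> X then f v else inv_into X f v)" for v
  have f1: "f v \<in> S - X" "inv_into X f (f v) = v" if "v \<in> X" for v
    using f that by (auto simp: bij_betw_def)
  have f2: "inv_into X f v \<in> X" "f (inv_into X f v) = v" if "v \<in> S" "v \<notin> X" for v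
    using f that by (auto simp: bij_betw_def f_inv_into_f intro: inv_into_into)
  have "A \<subseteq> X" "B \<subseteq> X" "g \<in> X" "h \<in> X" "R \<inter> (A \<union> B) = {}" using gh R by (auto simp: X_def)
  then have "roommates_gadget S X A B \<sigma> g h"
    by unfold_locales (use assms(1,5) X gh f1 f2 in \<open>auto simp: \<sigma>_def\<close>)
  then show ?thesis by blast
qed

section \<open>The lower bound\<close>

text \<open>A batch with at least a quarter of the agents works alone. Otherwise, adding batches one
  by one, each increment is below a quarter, so the union cannot jump over the range from a quarter
  to a half.\<close>

lemma batching_side:
  assumes "finite S" "S \<noteq> {}" "batching S \<B>"
  shows "\<exists>A\<subseteq>S. (\<forall>B\<in>\<B>. B \<subseteq> A \<or> B \<inter> A = {}) \<and> card S \<le> 4 * card A \<and> 2 * card A \<le> card S"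
proof -
  have part: "\<Union>\<B> = S" "disjoint \<B>" using assms by (auto simp: batching_def partition_on_def)
  have finB: "finite \<B>" using part(1) assms(1) finite_UnionD by auto
  have half: "2 * card B \<le> card S" if "B \<in> \<B>" for B
  proof -
    have "real (card B) \<le> real (card S) / 2" using assms(3) that by (simp add: batching_def)
    then show ?thesis by linarith
  qed
  let ?good = "\<lambda>\<C>. card S \<le> 4 * card (\<Union>\<C>) \<and> 2 * card (\<Union>\<C>) \<le> card S"
  have "(\<exists>\<C>\<subseteq>\<D>. ?good \<C>) \<or> 4 * card (\<Union>\<D>) < card S" if "finite \<D>" "\<D> \<subseteq> \<B>" for \<D>
    using that
  proof (induction \<D> rule: finite_induct)
    case empty
    then show ?case using assms(1,2) by (simp add: card_gt_0_iff)
  next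
    case (insert B \<D>)
    show ?case
    proof (rule ccontr)
      assume neg: "\<not> ?case"
      have good: "\<not> ?good \<C>" if "\<C> \<subseteq> insert B \<D>" for \<C> using neg that by blast
      have "4 * card (\<Union>\<D>) < card S" using insert.IH insert.prems good by blast
      moreover have "4 * card B < card S" using good[of "{B}"] half[of B] insert.prems by auto
      moreover have "card (\<Union>(insert B \<D>)) \<le> card B + card (\<Union>\<D>)" by (simp add: card_Un_le)
      ultimately have "2 * card (\<Union>(insert B \<D>)) \<le> card S" by linarith
      then show False using neg good[of "insert B \<D>"] by simp
    qed
  qed
  from this[OF finB] part(1) obtain \<C> where C: "\<C> \<subseteq> \<B>" "?good \<C>" by auto
  have "B \<subseteq> \<Union>\<C> \<or> B \<inter> \<Union>\<C> = {}" if "B \<in> \<B>" for B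
  proof (cases "B \<in> \<C>")
    case False
    then have "B \<inter> B' = {}" if "B' \<in> \<C>" for B'
      using that \<open>B \<in> \<B>\<close> C(1) part(2) by (intro disjointD[of \<B>]) auto
    then show ?thesis by blast
  qed auto
  then show ?thesis using C part(1) by (intro exI[of _ "\<Union>\<C>"]) auto
qed

text \<open>The advantage bound for fixed trees is averaged over \<open>D\<close>. The constant is
  \<open>49152 = 192 * 256\<close>: 192 from the final estimate on \<open>\<theta>\<close>, and 256
  because \<open>A\<close> and \<open>B\<close> each hold more than a sixteenth of the
  agents.\<close>

lemma randomized_decider_lower_bound:
  assumes S: "finite S" "even (card S)" "16 \<le> card S" "batching S \<B>"
    and p: "1 / 2 < p" and D: "randomized_decider p S \<B> D"
  shows "\<exists>P. sr_instance S P \<and>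
    ennreal ((2 * p - 1)\<^sup>2 / 49152 * real (card S) ^ 2) \<le> expected_queries D P"
proof (rule ccontr)
  assume neg: "\<not> ?thesis"
  define \<theta> where "\<theta> = (2 * p - 1)\<^sup>2 / 49152 * real (card S) ^ 2"
  \<comment> \<open>An eighth fits into both sides, each holding at least a quarter of the agents,
    and leaves room for the gadget.\<close>
  define m where "m = card S div 8"
  define \<epsilon> where "\<epsilon> = 2 * p - 1"
  have eps: "\<epsilon> > 0" using p by (simp add: \<epsilon>_def)
  have m: "real (card S) < 16 * real m" "8 * m \<le> card S" using S(3) unfolding m_def by linarith+
  obtain A0 where A0: "A0 \<subseteq> S" "\<And>B. B \<in> \<B> \<Longrightarrow> B \<subseteq> A0 \<or> B \<inter> A0 = {}"
    "card S \<le> 4 * card A0" "2 * card A0 \<le> card S"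
    using batching_side[OF S(1) _ S(4)] S(3) by force
  have fA0: "finite A0" using A0 S finite_subset by blast
  have "m \<le> card A0" using m(2) A0(3) by linarith
  then obtain A where A: "A \<subseteq> A0" "card A = m" using obtain_subset_with_card_n by metis
  have "card (S - A0) = card S - card A0" using A0 fA0 by (simp add: card_Diff_subset)
  then have "m \<le> card (S - A0)" using m(2) A0(4) by linarith
  then obtain B where B: "B \<subseteq> S - A0" "card B = m" using obtain_subset_with_card_n by metis
  have "2 * (card A + card B) + 4 \<le> card S" using A(2) B(2) m(2) S(3) by simp
  then obtain X \<sigma> g h where "roommates_gadget S X A B \<sigma> g h"
    using roommates_gadget_exists[OF S(1,2), of A B] A B A0 by blast
  then interpret roommates_gadget S X A B \<sigma> g h .
  interpret D: prob_space D using D by (simp add: randomized_decider_def randomized_mechanism_def)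
  define U where "U = A \<times> B"
  have U: "finite U" "card U = m * m" using finite_AB A B by (auto simp: U_def card_cartesian_product)
  define W where "W = (2::real) ^ card U / 2"
  have W: "W > 0" by (simp add: W_def)
  have inst: "sr_instance S (profile_of x y)" for x y by (rule sr_instance_profile_of)
  have meas: "(\<lambda>t. run t (profile_of x y)) \<in> measurable D (count_space UNIV)"
    "(\<lambda>t. num_queries t (profile_of x y)) \<in> measurable D (count_space UNIV)" for x y
    using D inst[of x y] by (auto simp: randomized_decider_def randomized_mechanism_def)
  define q where "q x y = D.prob {t\<in>space D. run t (profile_of x y)}" for x y
  have setsq: "{t\<in>space D. run t (profile_of x y)} \<in> sets D" for x y
    using meas(1) by measurable
  have run_int: "integrable D (\<lambda>t. of_bool (run t (profile_of x y)) :: real)"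
    "(\<integral>t. of_bool (run t (profile_of x y)) \<partial>D) = q x y" for x y
  proof -
    have *: "of_bool (run t (profile_of x y)) = (indicator {t\<in>space D. run t (profile_of x y)} t :: real)"
      if "t \<in> space D" for t using that by (simp add: indicator_def)
    show "integrable D (\<lambda>t. of_bool (run t (profile_of x y)) :: real)"
      using setsq[of x y] by (subst Bochner_Integration.integrable_cong[OF refl *]) (auto simp: integrable_indicator_iff less_top[symmetric])
    show "(\<integral>t. of_bool (run t (profile_of x y)) \<partial>D) = q x y"
      using setsq[of x y] by (subst Bochner_Integration.integral_cong[OF refl *]) (auto simp: q_def intro!: arg_cong[where f = D.prob])
  qed
  \<comment> \<open>The negated claim bounds the expected count on every instance, which also makes
    the count integrable.\<close>
  have num_int: "integrable D (\<lambda>t. real (num_queries t (profile_of x y)))"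
    "(\<integral>t. real (num_queries t (profile_of x y)) \<partial>D) \<le> \<theta>" for x y
  proof -
    have lt: "(\<integral>\<^sup>+ t. ennreal (real (num_queries t (profile_of x y))) \<partial>D) < ennreal \<theta>"
      using neg inst[of x y] by (auto simp: \<theta>_def expected_queries_def not_le)
    have ms: "(\<lambda>t. real (num_queries t (profile_of x y))) \<in> borel_measurable D"
      using meas(2)[of x y] by measurable
    show int: "integrable D (\<lambda>t. real (num_queries t (profile_of x y)))"
      using lt ms by (intro integrableI_nonneg) (auto intro: less_trans[OF _ ennreal_less_top])
    have "ennreal (\<integral>t. real (num_queries t (profile_of x y)) \<partial>D) < ennreal \<theta>"
      using lt by (subst nn_integral_eq_integral[symmetric, OF int]) auto
    then show "(\<integral>t. real (num_queries t (profile_of x y)) \<partial>D) \<le> \<theta>"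
      by (simp add: ennreal_less_iff integral_nonneg_AE)
  qed
  have q_solvable: "p \<le> q x y" if "x \<inter> y = {}" for x y
    using D inst[of x y] solvable_of_disjoint[OF that] by (auto simp: randomized_decider_def q_def)
  have q_unsolvable: "q x y \<le> 1 - p" if "k \<in> U" "k \<in> x" "k \<in> y" for k x y
  proof -
    obtain a b where "k = (a, b)" "a \<in> A" "b \<in> B" using \<open>k \<in> U\<close> by (auto simp: U_def)
    then have "\<not> solvable S (profile_of x y)" using not_solvable_of_common that by auto
    then have "p \<le> D.prob {t\<in>space D. \<not> run t (profile_of x y)}"
      using D inst[of x y] by (auto simp: randomized_decider_def)
    also have "\<dots> = 1 - q x y" unfolding q_def by (rule D.prob_neg[OF setsq])
    finally show ?thesis by simp
  qed
  have card_V: "real (card (Pow (U - {k}))) = W" if "k \<in> U" for k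
    unfolding W_def by (rule real_card_Pow_remove[OF U(1) that])
  let ?adv = "\<lambda>t. \<Sum>k\<in>U. \<Sum>E\<in>Pow (U - {k}). \<Sum>w\<in>Pow (U - {k}).
     of_bool (run t (profile_of (w \<inter> E) (w - E)))
     - (of_bool (run t (profile_of (insert k (w \<inter> E)) (insert k (w - E)))) :: real)"
  let ?cost = "\<lambda>t. \<Sum>C\<in>Pow U. \<Sum>z\<in>Pow U. real (num_queries t (profile_of (z \<inter> C) (z - C)))"
  \<comment> \<open>\<open>\<tau> = \<epsilon> / 4\<close> makes the error term half of the
    advantage that correctness forces.\<close>
  have adv_le: "?adv t \<le> 6 / (\<epsilon> / 4) * ?cost t + 2 * (\<epsilon> / 4) * card U * (2 ^ card U / 2)\<^sup>2"
    if t: "t \<in> space D" for t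
  proof (rule disjointness_advantage_le[where f = "\<lambda>x y. trace t (profile_of x y)"])
    have t: "queries_only \<B> t" using D t by (simp add: randomized_decider_def randomized_mechanism_def)
    show "trace t (profile_of x y') = trace t (profile_of x y)"
      if "trace t (profile_of x y) = trace t (profile_of x' y')" for x y x' y'
      by (rule trace_rectangle[OF t A0(2) that]) (use A B in \<open>auto intro: profile_of_cong\<close>)
    show "run t (profile_of x y) = run t (profile_of x' y')"
      if "trace t (profile_of x y) = trace t (profile_of x' y')" for x y x' y'
      by (rule run_cong_trace[OF that])
    fix C assume "C \<subseteq> U"
    have "(\<Sum>z\<in>Pow U. ln (card (Pow U) / card {z'\<in>Pow U. trace t (profile_of (z' \<inter> C) (z' - C)) = trace t (profile_of (z \<inter> C) (z - C))}))
      \<le> ln 2 * (\<Sum>z\<in>Pow U. real (num_queries t (profile_of (z \<inter> C) (z - C))))"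
      using trace_entropy_le[of "Pow U" t "\<lambda>z. profile_of (z \<inter> C) (z - C)"] U(1) by simp
    also have "\<dots> \<le> 1 * (\<Sum>z\<in>Pow U. real (num_queries t (profile_of (z \<inter> C) (z - C))))"
      using ln_le_minus_one[of 2] by (intro mult_right_mono sum_nonneg) auto
    finally show "(\<Sum>z\<in>Pow U. ln (card (Pow U) / card {z'\<in>Pow U. trace t (profile_of (z' \<inter> C) (z' - C)) = trace t (profile_of (z \<inter> C) (z - C))}))
      \<le> (\<Sum>z\<in>Pow U. real (num_queries t (profile_of (z \<inter> C) (z - C))))" by simp
  qed (use U eps in auto)
  \<comment> \<open>Each term compares a disjoint pair with one meeting in \<open>k\<close>, so
    correctness forces a gap of \<open>p - (1 - p) = \<epsilon>\<close> in acceptance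
    probability.\<close>
  have "card U * W\<^sup>2 * \<epsilon> = (\<Sum>k\<in>U. \<Sum>E\<in>Pow (U - {k}). \<Sum>w\<in>Pow (U - {k}). \<epsilon>)"
    by (simp add: card_V power2_eq_square)
  also have "\<dots> \<le> (\<Sum>k\<in>U. \<Sum>E\<in>Pow (U - {k}). \<Sum>w\<in>Pow (U - {k}).
      q (w \<inter> E) (w - E) - q (insert k (w \<inter> E)) (insert k (w - E)))"
  proof (intro sum_mono)
    fix k E w assume "k \<in> U"
    then have "q (insert k (w \<inter> E)) (insert k (w - E)) \<le> 1 - p" by (intro q_unsolvable[of k]) auto
    moreover have "p \<le> q (w \<inter> E) (w - E)" by (intro q_solvable) auto
    ultimately show "\<epsilon> \<le> q (w \<inter> E) (w - E) - q (insert k (w \<inter> E)) (insert k (w - E))"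
      by (simp add: \<epsilon>_def)
  qed
  also have "\<dots> = (\<integral>t. ?adv t \<partial>D)"
    by (simp add: Bochner_Integration.integral_sum Bochner_Integration.integral_diff run_int)
  also have "\<dots> \<le> (\<integral>t. 6 / (\<epsilon> / 4) * ?cost t + 2 * (\<epsilon> / 4) * card U * (2 ^ card U / 2)\<^sup>2 \<partial>D)"
    by (intro integral_mono adv_le Bochner_Integration.integrable_sum Bochner_Integration.integrable_diff
        Bochner_Integration.integrable_add integrable_mult_right run_int num_int D.integrable_const)
  also have "\<dots> = 6 / (\<epsilon> / 4) * (\<Sum>C\<in>Pow U. \<Sum>z\<in>Pow U. \<integral>t. real (num_queries t (profile_of (z \<inter> C) (z - C))) \<partial>D)
      + 2 * (\<epsilon> / 4) * card U * W\<^sup>2"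
    by (subst Bochner_Integration.integral_add)
      (auto intro!: Bochner_Integration.integrable_sum integrable_mult_right num_int
        simp: Bochner_Integration.integral_sum num_int D.prob_space W_def simp del: times_divide_eq_left)
  also have "\<dots> \<le> 6 / (\<epsilon> / 4) * (\<Sum>C\<in>Pow U. \<Sum>z\<in>Pow U. \<theta>) + 2 * (\<epsilon> / 4) * card U * W\<^sup>2"
    using eps by (intro add_right_mono mult_left_mono sum_mono num_int) auto
  also have "(\<Sum>C\<in>Pow U. \<Sum>z\<in>Pow U. \<theta>) = 4 * W\<^sup>2 * \<theta>"
    using U(1) by (simp add: W_def card_Pow power2_eq_square)
  finally have "(card U * \<epsilon>) * W\<^sup>2 \<le> (96 / \<epsilon> * \<theta> + \<epsilon> / 2 * card U) * W\<^sup>2"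
    by (simp add: algebra_simps)
  then have "card U * \<epsilon> \<le> 96 / \<epsilon> * \<theta> + \<epsilon> / 2 * card U" using W by simp
  then have "card U * \<epsilon>\<^sup>2 \<le> 192 * \<theta>" using eps by (simp add: field_simps power2_eq_square)
  also have "192 * \<theta> = \<epsilon>\<^sup>2 * ((real (card S))\<^sup>2 / 256)" by (simp add: \<theta>_def \<epsilon>_def)
  also have "\<dots> < \<epsilon>\<^sup>2 * card U"
  proof -
    have "(real (card S))\<^sup>2 < (16 * real m)\<^sup>2" using m(1) by (intro power_strict_mono) auto
    then show ?thesis using eps by (simp add: U(2) power2_eq_square)
  qed
  finally show False by simp
qed

theorem theorem4:
  fixes p :: real
  assumes "1 / 2 < p"
  shows "\<exists>c::real. c > 0 \<and> (\<exists>N::nat. \<forall>n\<ge>N. even n \<longrightarrow>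
    (\<forall>(S :: 'a set) \<B>. finite S \<and> card S = n \<and> batching S \<B> \<longrightarrow>
      (\<forall>D. randomized_decider p S \<B> D \<longrightarrow>
         (\<exists>P. sr_instance S P \<and> ennreal (c * real n ^ 2) \<le> expected_queries D P)) \<and>
      (\<forall>t. deterministic_decider S \<B> t \<longrightarrow>
         (\<exists>P. sr_instance S P \<and> c * real n ^ 2 \<le> real (num_queries t P)))))"
proof -
  \<comment> \<open>Capping at 1 allows a deterministic decider, which succeeds with probability
    exactly 1, to count as a randomized one with the same constant \<open>c\<close>.\<close>
  define p' where "p' = min p 1"
  define c where "c = (2 * p' - 1)\<^sup>2 / 49152"
  have p': "1 / 2 < p'" "p' \<le> p" "p' \<le> 1" using assms by (auto simp: p'_def)
  have "c > 0" using p' by (simp add: c_def)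
  moreover have "(\<forall>D. randomized_decider p S \<B> D \<longrightarrow>
         (\<exists>P. sr_instance S P \<and> ennreal (c * real n ^ 2) \<le> expected_queries D P)) \<and>
      (\<forall>t. deterministic_decider S \<B> t \<longrightarrow>
         (\<exists>P. sr_instance S P \<and> c * real n ^ 2 \<le> real (num_queries t P)))"
    if "16 \<le> n" "even n" and S: "finite S" "card S = n" "batching S \<B>" for n \<B> and S :: "'a set"
  proof -
    have bound: "\<exists>P. sr_instance S P \<and> ennreal (c * real n ^ 2) \<le> expected_queries D P"
      if "randomized_decider p' S \<B> D" for D
      using randomized_decider_lower_bound[of S \<B> p' D] that p' S \<open>16 \<le> n\<close> \<open>even n\<close>
      unfolding c_def by auto
    have "\<exists>P. sr_instance S P \<and> ennreal (c * real n ^ 2) \<le> expected_queries D P"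
      if "randomized_decider p S \<B> D" for D
      using that p'(2) by (intro bound) (auto simp: randomized_decider_def intro: order_trans)
    moreover have "\<exists>P. sr_instance S P \<and> c * real n ^ 2 \<le> real (num_queries t P)"
      if t: "deterministic_decider S \<B> t" for t
    proof -
      \<comment> \<open>The point mass on a one-point space: every mechanism in
        \<open>space D\<close> is then \<open>t\<close>, and measurability is trivial.\<close>
      define D where "D = return (count_space {t}) t"
      have D: "prob_space D" "space D = {t}" "sets D = Pow {t}"
        by (auto simp: D_def intro!: prob_space_return)
      have "measure D {s \<in> space D. run s P = solvable S P} = 1" if "sr_instance S P" for P
      proof -
        have "{s \<in> space D. run s P = solvable S P} = space D"
          using t that D(2) by (auto simp: deterministic_decider_def)
        then show ?thesis using D(1) prob_space.prob_space by simp
      qed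
      then have "randomized_decider p' S \<B> D"
        using t p'(3) D unfolding randomized_decider_def randomized_mechanism_def
        by (auto simp: deterministic_decider_def measurable_def)
      then obtain P where P: "sr_instance S P" "ennreal (c * real n ^ 2) \<le> expected_queries D P"
        using bound by blast
      have "expected_queries D P = ennreal (real (num_queries t P))"
        unfolding expected_queries_def D_def by (subst nn_integral_return) auto
      then show ?thesis using P by (auto simp: ennreal_le_iff)
    qed
    ultimately show ?thesis by blast
  qed
  ultimately show ?thesis by blast
qed

end
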